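(* Let $\pi$ be a Borel probability measure on $\mathbb R^d$ with compact support $K$. Then a typical measure $\mu\in\mathcal P(K)$ satisfies, for $q\in\mathbb R$, $$\underline{\dim}^{*,q}_{\pi,B}(\mu)=\begin{cases}-q\,\overline D_{\pi,\mathrm{unif}}(-\infty)&\text{provided } q\ge0,\\ -q\,\underline D_{\pi,\mathrm{unif}}(+\infty)&\text{provided } q\le0.\end{cases}$$
   Context: $\mathcal P(K)$ is the set of Borel probability measures on $K$, endowed with the weak topology. A property holds for a typical measure of $\mathcal P(K)$ if it is satisfied by all elements of some dense $G_\delta$ subset of $\mathcal P(K)$. $B(x,r)$ is the open ball of centre $x$ and radius $r$ in $\mathbb R^d$. For $E\subset K$, $r>0$ and $q\in\mathbb R$ let $$\mathbf N_\pi^q(E,r)=\inf\sum_i\pi\big(B(x_i,r)\big)^q,$$ the infimum being over all at most countable families of balls $(B(x_i,r))_i$ with centres $x_i\in K$ covering $E$. The lower covering multifractal box dimension of $E$ of order $q$ with respect to $\pi$ is $$\underline{\dim}_{\pi,B}^q(E)=\liminf_{r\to0^+}\frac{\log\mathbf N_\pi^q(E,r)}{-\log r}.$$ For $\mu\in\mathcal P(K)$, the big lower multifractal box dimension of $\mu$ of order $q$ with respect to $\pi$ is $$\underline{\dim}^{*,q}_{\pi,B}(\mu)=\lim_{\varepsilon\to0^+}\inf_{\mu(E)>1-\varepsilon}\underline{\dim}_{\pi,B}^q(E),$$ where $E$ ranges over Borel subsets of $K$. Define, with values in $[0,+\infty]$, $$\overline D_{\pi,\mathrm{unif}}(-\infty)=\inf_{N\ge1}\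 \inf_{\substack{y_1,\dots,y_N\in K\\ \rho>0}}\ \limsup_{r\to0^+}\ \inf_{i=1,\dots,N}\frac{\log\big(\inf_{x\in K\cap B(y_i,\rho)}\pi(B(x,r))\big)}{\log r},$$ $$\underline D_{\pi,\mathrm{unif}}(+\infty)=\sup_{N\ge1}\ \sup_{\substack{y_1,\dots,y_N\in K\\ \rho>0}}\ \liminf_{r\to0^+}\ \sup_{i=1,\dots,N}\frac{\log\big(\sup_{x\in K\cap B(y_i,\rho)}\pi(B(x,r))\big)}{\log r}.$$ Convention: $0\cdot(+\infty)=0$. *)

theory Defs
  imports "HOL-Probability.Probability"
begin

definition msupport :: "'a::topological_space measure \<Rightarrow> 'a set" where
  "msupport M = {x. \<forall>U. open U \<and> x \<in> U \<longrightarrow> 0 < emeasure M U}"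

text \<open>\<open>\<P>(K)\<close>: Borel probability measures on the subspace \<open>K\<close>, i.e. measures with space \<open>K\<close>.\<close>
definition borel_probs :: "'a::topological_space set \<Rightarrow> 'a measure set" where
  "borel_probs K = {\<mu>. prob_space \<mu> \<and> sets \<mu> = sets (restrict_space borel K)}"

text \<open>The coarsest topology making \<open>\<mu> \<mapsto> \<integral>f d\<mu>\<close> continuous for every bounded continuous
  \<open>f: K \<rightarrow> \<real>\<close>. Its carrier is all of \<open>borel_probs K\<close> (take \<open>f = 0\<close> and \<open>U = UNIV\<close>).\<close>
definition weak_topology :: "'a::topological_space set \<Rightarrow> 'a measure topology" where
  "weak_topology K = topology_generated_by
     {{\<mu> \<in> borel_probs K. (\<integral>x. f x \<partial>\<mu>) \<in> U} | (f :: 'a \<Rightarrow> real) U.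
        continuous_on K f \<and> bounded (f ` K) \<and> open U}"

definition typical :: "'a::topological_space set \<Rightarrow> ('a measure \<Rightarrow> bool) \<Rightarrow> bool" where
  "typical K P \<longleftrightarrow>
     (\<exists>G. gdelta_in (weak_topology K) G \<and>
          weak_topology K closure_of G = topspace (weak_topology K) \<and>
          (\<forall>\<mu>\<in>G. P \<mu>))"

text \<open>Logarithm on \<open>[0, +\<infinity>]\<close> with \<open>log 0 = -\<infinity>\<close> and \<open>log (+\<infinity>) = +\<infinity>\<close>.\<close>
definition eln :: "ennreal \<Rightarrow> ereal" where
  "eln x = (if x = 0 then -\<infinity> else if x = \<infinity> then \<infinity> else ereal (ln (enn2real x)))"

text \<open>The at most countable families are those indexed by a set of natural numbers.
  For \<open>x \<in> K = msupport \<pi>\<close> the measure of a ball around \<open>x\<close> is positive, so \<open>powr\<close> is the usual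
  real power for every sign of \<open>q\<close>, in particular \<open>t powr 0 = 1\<close>.\<close>
definition cov_num ::
  "'a::metric_space measure \<Rightarrow> 'a set \<Rightarrow> real \<Rightarrow> 'a set \<Rightarrow> real \<Rightarrow> ennreal" where
  "cov_num \<pi> K q E r =
     (INF (I, x) \<in> {(I :: nat set, x :: nat \<Rightarrow> 'a). x ` I \<subseteq> K \<and> E \<subseteq> (\<Union>i\<in>I. ball (x i) r)}.
        (\<Sum>\<^sub>\<infinity>i\<in>I. ennreal (measure \<pi> (ball (x i) r) powr q)))"

definition lower_box_dim ::
  "'a::metric_space measure \<Rightarrow> 'a set \<Rightarrow> real \<Rightarrow> 'a set \<Rightarrow> ereal" where
  "lower_box_dim \<pi> K q E =
     Liminf (at_right 0) (\<lambda>r. eln (cov_num \<pi> K q E r) / ereal (- ln r))"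

definition big_lower_box_dim ::
  "'a::metric_space measure \<Rightarrow> 'a set \<Rightarrow> real \<Rightarrow> 'a measure \<Rightarrow> ereal" where
  "big_lower_box_dim \<pi> K q \<mu> =
     Lim (at_right 0) (\<lambda>\<epsilon>. INF E \<in> {E. E \<in> sets borel \<and> E \<subseteq> K \<and> measure \<mu> E > 1 - \<epsilon>}.
        lower_box_dim \<pi> K q E)"

definition D_unif_upper_minf :: "'a::metric_space measure \<Rightarrow> 'a set \<Rightarrow> ereal" where
  "D_unif_upper_minf \<pi> K =
     (INF N \<in> {1::nat..}. INF (y, \<rho>) \<in> {(y :: nat \<Rightarrow> 'a, \<rho> :: real). y ` {1..N} \<subseteq> K \<and> 0 < \<rho>}.
        Limsup (at_right 0) (\<lambda>r. INF i \<in> {1..N}.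
          eln (INF x \<in> K \<inter> ball (y i) \<rho>. emeasure \<pi> (ball x r)) / ereal (ln r)))"

definition D_unif_lower_pinf :: "'a::metric_space measure \<Rightarrow> 'a set \<Rightarrow> ereal" where
  "D_unif_lower_pinf \<pi> K =
     (SUP N \<in> {1::nat..}. SUP (y, \<rho>) \<in> {(y :: nat \<Rightarrow> 'a, \<rho> :: real). y ` {1..N} \<subseteq> K \<and> 0 < \<rho>}.
        Liminf (at_right 0) (\<lambda>r. SUP i \<in> {1..N}.
          eln (SUP x \<in> K \<inter> ball (y i) \<rho>. emeasure \<pi> (ball x r)) / ereal (ln r)))"

end

theory Submission
  imports Defs
begin

text \<open>Write \<open>m\<close> for the measure \<open>\<pi> (ball x r)\<close> of a ball with centre in \<open>K\<close>. Two properties of a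
  measure \<open>\<mu>\<close> determine its dimensions, for all \<open>q\<close> at once.

  \<^emph>\<open>Lower bound: full support.\<close> If \<open>q > 0\<close> and \<open>c\<close> exceeds the upper uniform dimension at
  \<open>-\<infinity>\<close>, there are finitely many balls \<open>ball (y i) \<rho>\<close> such that, at every small scale \<open>r\<close>, in one
  of them all \<open>r\<close>-balls satisfy \<open>m \<ge> r powr c\<close>. When \<open>\<mu>\<close> has full support, a set of nearly full
  measure meets each \<open>ball (y i) (\<rho> / 2)\<close>, so that any cover of it contains an \<open>r\<close>-ball centred
  in the favourable one; the weight \<open>m powr q\<close> of this ball alone is at least \<open>r powr (q * c)\<close>.
  For \<open>q < 0\<close> and \<open>c\<close> below the lower uniform dimension at \<open>+\<infinity>\<close> the argument is the same, with
  \<open>m \<le> r powr c\<close>. This is \<open>big_lower_box_dim_ge_if_full_support\<close>.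

  \<^emph>\<open>Upper bound: concentration on few balls of prescribed measure.\<close> If \<open>c\<close> is below the upper
  uniform dimension at \<open>-\<infinity>\<close>, then near any finite set of points there are, at arbitrarily small
  scales \<open>r\<close>, centres with \<open>m \<le> r powr c\<close>. A measure with finitely many atoms can therefore be
  perturbed to one carried by such centres, and their number, being fixed before \<open>r\<close>, is
  negligible against powers of \<open>r\<close>. A measure which is approximated in this way along a sequence
  of scales has sets of nearly full measure whose covering number at these scales is at most about
  \<open>r powr (q * c)\<close>, and such a sequence of scales is enough to bound a lower limit from above. For
  \<open>q < 0\<close> use centres with \<open>m \<ge> r powr c\<close>, which exist when \<open>c\<close> exceeds the lower uniform dimension at \<open>+\<infinity>\<close>. This is
  \<open>big_lower_box_dim_le_if_concentrated\<close>.

  Both properties hold for typical \<open>\<mu>\<close> (\<open>typical_full_support_concentrated\<close>). They are countable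
  intersections of weakly open conditions, because \<open>\<mu> \<mapsto> \<mu> V\<close> is lower semicontinuous for open
  \<open>V\<close>. Density comes from a Baire argument on families of atoms: for fixed weights \<open>P\<close> of
  infinite support the map sending a family \<open>y\<close> of points of \<open>K\<close> to \<open>\<Sum>i. P(i) \<delta>\<^bsub>y i\<^esub>\<close> is weakly continuous on the compact
  product of copies of \<open>K\<close>, each condition is dense there, and the atomic measures are weakly
  dense.\<close>

section \<open>The weak topology\<close>

lemma topspace_weak_topology: "topspace (weak_topology K) = borel_probs K"
proof -
  have "borel_probs K \<in> {{\<mu> \<in> borel_probs K. (\<integral>x. f x \<partial>\<mu>) \<in> U} | (f :: 'a \<Rightarrow> real) U.
        continuous_on K f \<and> bounded (f ` K) \<and> open U}"
    by (rule CollectI, rule exI[of _ "\<lambda>_. 0"], rule exI[of _ UNIV]) (auto simp: image_def)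
  then show ?thesis
    unfolding weak_topology_def topology_generated_by_topspace by blast
qed

lemma space_borel_probs: "\<mu> \<in> borel_probs K \<Longrightarrow> space \<mu> = K"
  using sets_eq_imp_space_eq[of \<mu> "restrict_space borel K"]
  by (auto simp: borel_probs_def space_restrict_space)

lemma sets_borel_probs:
  assumes "\<mu> \<in> borel_probs K" "K \<in> sets borel"
  shows "A \<in> sets \<mu> \<longleftrightarrow> A \<in> sets borel \<and> A \<subseteq> K"
  using assms by (auto simp: borel_probs_def sets_restrict_space_iff)

lemma integrable_borel_probs:
  fixes f :: "'a::topological_space \<Rightarrow> real"
  assumes "\<mu> \<in> borel_probs K" "continuous_on K f" "bounded (f ` K)"
  shows "integrable \<mu> f"
proof -
  interpret prob_space \<mu> using assms(1) by (simp add: borel_probs_def)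
  have "sets \<mu> = sets (restrict_space borel K)" using assms(1) by (simp add: borel_probs_def)
  then have m: "f \<in> borel_measurable \<mu>"
    using borel_measurable_continuous_on_restrict[OF assms(2)] measurable_cong_sets by blast
  obtain B where "\<And>x. x \<in> K \<Longrightarrow> norm (f x) \<le> B" using assms(3) by (auto simp: bounded_iff)
  then show ?thesis
    using m space_borel_probs[OF assms(1)] by (intro integrable_const_bound[of _ B]) auto
qed

lemma openin_weak_integral_greater:
  fixes f :: "'a::topological_space \<Rightarrow> real"
  assumes "continuous_on K f" "bounded (f ` K)"
  shows "openin (weak_topology K) {\<mu> \<in> borel_probs K. a < (\<integral>x. f x \<partial>\<mu>)}"
  unfolding weak_topology_def
  by (rule topology_generated_by_Basis, rule CollectI, rule exI[of _ f], rule exI[of _ "{a<..}"])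
     (use assms in auto)

text \<open>Lower semicontinuity of \<open>\<mu> \<mapsto> \<mu> V\<close> on an open set \<open>V\<close>: the indicator of \<open>V\<close> is the
  increasing limit of the continuous functions \<open>min 1 (n \<cdot> infdist x (- V))\<close>, so \<open>\<mu> V > a\<close> holds
  iff one of their integrals exceeds \<open>a\<close>.\<close>
lemma openin_weak_measure_greater:
  fixes K :: "'a::metric_space set"
  assumes "K \<in> sets borel" "open V"
  shows "openin (weak_topology K) {\<mu> \<in> borel_probs K. a < measure \<mu> (V \<inter> K)}"
  \<comment> \<open>\<open>infdist x {} = 0\<close>, so the whole space has to be treated apart.\<close>
proof (cases "V = UNIV")
  case True
  have *: "measure \<mu> K = 1" if "\<mu> \<in> borel_probs K" for \<mu>
    using that space_borel_probs[OF that] prob_space.prob_space[of \<mu>] by (simp add: borel_probs_def)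
  show ?thesis
  proof (cases "a < 1")
    case True
    then have "{\<mu> \<in> borel_probs K. a < measure \<mu> (V \<inter> K)} = topspace (weak_topology K)"
      using * \<open>V = UNIV\<close> by (auto simp: topspace_weak_topology)
    then show ?thesis by simp
  next
    case False
    then have "{\<mu> \<in> borel_probs K. a < measure \<mu> (V \<inter> K)} = {}"
      using * \<open>V = UNIV\<close> by auto
    then show ?thesis by (metis openin_empty)
  qed
next
  case False
  define f where "f n x = min 1 (real n * infdist x (- V))" for n x
  have cont: "continuous_on K (f n)" for n
    unfolding f_def by (intro continuous_intros)
  have f01: "0 \<le> f n x" "f n x \<le> 1" for n x
    by (auto simp: f_def infdist_nonneg)
  have bdd: "bounded (f n ` K)" for n
    using f01 by (auto simp: bounded_iff intro!: exI[of _ 1])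
  have le_ind: "f n x \<le> indicator V x" for n x
    using f01(2)[of n x] by (cases "x \<in> V") (auto simp: f_def)
  have lim: "(\<lambda>n. f n x) \<longlonglongrightarrow> indicator V x" for x
  proof (cases "x \<in> V")
    case True
    have "closed (- V)" "- V \<noteq> {}" using \<open>open V\<close> \<open>V \<noteq> UNIV\<close> by auto
    then have "infdist x (- V) > 0"
      using True by (metis ComplD in_closed_iff_infdist_zero infdist_nonneg order_le_less)
    then obtain m where m: "1 < real m * infdist x (- V)"
      using ex_less_of_nat_mult by blast
    have "f n x = 1" if "n \<ge> m" for n
    proof -
      have "1 < real n * infdist x (- V)"
        using m that by (smt (verit) infdist_nonneg mult_right_mono of_nat_mono)
      then show ?thesis by (simp add: f_def)
    qed
    then have "\<forall>\<^sub>F n in sequentially. f n x = 1"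
      by (auto simp: eventually_sequentially)
    then show ?thesis using True by (auto intro: tendsto_eventually)
  next
    case False
    then show ?thesis by (simp add: f_def)
  qed
  have iff: "a < measure \<mu> (V \<inter> K) \<longleftrightarrow> (\<exists>n. a < (\<integral>x. f n x \<partial>\<mu>))" if mu: "\<mu> \<in> borel_probs K" for \<mu>
  proof -
    interpret prob_space \<mu> using mu by (simp add: borel_probs_def)
    have sp: "space \<mu> = K" by (rule space_borel_probs[OF mu])
    have VK: "V \<inter> K \<in> sets \<mu>" using assms by (auto simp: sets_borel_probs[OF mu])
    have meas: "(indicator V :: 'a \<Rightarrow> real) \<in> borel_measurable \<mu>"
      using VK sp by (simp add: borel_measurable_indicator_iff)
    have int: "(\<integral>x. indicator V x \<partial>\<mu>) = measure \<mu> (V \<inter> K)"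
      using sp by simp
    have ii: "integrable \<mu> (indicator V :: 'a \<Rightarrow> real)"
      by (rule integrable_const_bound[of _ 1]) (use meas in auto)
    have fi: "integrable \<mu> (f n)" for n
      by (rule integrable_borel_probs[OF mu cont bdd])
    have "(\<lambda>n. \<integral>x. f n x \<partial>\<mu>) \<longlonglongrightarrow> (\<integral>x. indicator V x \<partial>\<mu>)"
      by (rule integral_dominated_convergence[where w = "\<lambda>_. 1"])
         (use meas fi lim f01 in \<open>auto intro: borel_measurable_integrable\<close>)
    then have lim': "(\<lambda>n. \<integral>x. f n x \<partial>\<mu>) \<longlonglongrightarrow> measure \<mu> (V \<inter> K)"
      unfolding int .
    have "(\<integral>x. f n x \<partial>\<mu>) \<le> measure \<mu> (V \<inter> K)" for n
      unfolding int[symmetric] using fi le_ind ii by (intro integral_mono) auto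
    moreover have "\<exists>n. a < (\<integral>x. f n x \<partial>\<mu>)" if "a < measure \<mu> (V \<inter> K)"
      using order_tendstoD(1)[OF lim' that] eventually_happens trivial_limit_sequentially by fast
    ultimately show ?thesis using order_less_le_trans by blast
  qed
  have "{\<mu> \<in> borel_probs K. a < measure \<mu> (V \<inter> K)} =
        (\<Union>n. {\<mu> \<in> borel_probs K. a < (\<integral>x. f n x \<partial>\<mu>)})"
    using iff by blast
  then show ?thesis
    using openin_weak_integral_greater[OF cont bdd] by auto
qed

text \<open>A map of \<open>K\<close> into itself that moves points by little moves the integral of a uniformly
  continuous function by little; hence the push-forward of \<open>\<mu>\<close> under such a map is weakly close
  to \<open>\<mu>\<close>.\<close>
lemma weak_open_contains_small_displacements:
  fixes K :: "'a::metric_space set"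
  assumes "compact K" "openin (weak_topology K) W" "\<mu> \<in> W"
  obtains \<delta> where "\<delta> > 0"
    "\<And>g. g \<in> measurable (restrict_space borel K) (restrict_space borel K) \<Longrightarrow>
         (\<And>x. x \<in> K \<Longrightarrow> dist (g x) x < \<delta>) \<Longrightarrow> distr \<mu> (restrict_space borel K) g \<in> W"
proof -
  let ?S = "restrict_space borel K :: 'a measure"
  define near where "near \<delta> g \<longleftrightarrow> g \<in> measurable ?S ?S \<and> (\<forall>x\<in>K. dist (g x) x < \<delta>)" for \<delta> g
  have near_mono: "near \<delta> g \<Longrightarrow> \<delta> \<le> \<delta>' \<Longrightarrow> near \<delta>' g" for \<delta> \<delta>' g
    by (force simp: near_def)
  have "generate_topology_on {{\<mu> \<in> borel_probs K. (\<integral>x. f x \<partial>\<mu>) \<in> U} | (f :: 'a \<Rightarrow> real) U.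
        continuous_on K f \<and> bounded (f ` K) \<and> open U} W"
    using assms(2) unfolding weak_topology_def openin_topology_generated_by_iff .
  then have "\<mu> \<in> W \<Longrightarrow> \<exists>\<delta>>0. \<forall>g. near \<delta> g \<longrightarrow> distr \<mu> ?S g \<in> W"
  proof (induction rule: generate_topology_on.induct)
    case Empty
    then show ?case by simp
  next
    case (Int a b)
    then obtain d e where "d > 0" "\<forall>g. near d g \<longrightarrow> distr \<mu> ?S g \<in> a"
      "e > 0" "\<forall>g. near e g \<longrightarrow> distr \<mu> ?S g \<in> b" by auto
    then show ?case
      by (intro exI[of _ "min d e"]) (auto dest: near_mono[of "min d e" _ d] near_mono[of "min d e" _ e])
  next
    case (UN \<A>)
    then show ?case by blast
  next
    case (Basis s)
    then obtain f :: "'a \<Rightarrow> real" and U where s: "s = {\<mu> \<in> borel_probs K. (\<integral>x. f x \<partial>\<mu>) \<in> U}"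
      and f: "continuous_on K f" "bounded (f ` K)" and U: "open U" by blast
    have mu: "\<mu> \<in> borel_probs K" "(\<integral>x. f x \<partial>\<mu>) \<in> U" using Basis s by auto
    interpret prob_space \<mu> using mu(1) by (simp add: borel_probs_def)
    have sets: "sets \<mu> = sets ?S" using mu(1) by (simp add: borel_probs_def)
    obtain e where e: "e > 0" "ball (\<integral>x. f x \<partial>\<mu>) e \<subseteq> U"
      using U mu(2) open_contains_ball by blast
    have "uniformly_continuous_on K f"
      using f(1) \<open>compact K\<close> compact_uniformly_continuous by blast
    then obtain d where d: "d > 0" "\<And>x y. x \<in> K \<Longrightarrow> y \<in> K \<Longrightarrow> dist y x < d \<Longrightarrow> dist (f y) (f x) < e / 2"
      unfolding uniformly_continuous_on_def using e(1) by (metis half_gt_zero)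
    have "distr \<mu> ?S g \<in> s" if g: "near d g" for g
    proof -
      have gm: "g \<in> measurable \<mu> ?S"
        using g sets measurable_cong_sets unfolding near_def by blast
      have gK: "g x \<in> K" if "x \<in> K" for x
        using measurable_space[OF gm] that by (simp add: space_borel_probs[OF mu(1)] space_restrict_space)
      have dg: "distr \<mu> ?S g \<in> borel_probs K"
        using gm by (simp add: borel_probs_def prob_space_distr)
      have fm: "f \<in> borel_measurable ?S"
        by (rule borel_measurable_continuous_on_restrict[OF f(1)])
      have "(\<integral>x. f x \<partial>distr \<mu> ?S g) = (\<integral>x. f (g x) \<partial>\<mu>)"
        by (rule integral_distr[OF gm fm])
      moreover have i1: "integrable \<mu> (\<lambda>x. f (g x))"
        using integrable_borel_probs[OF dg f] integrable_distr_eq[OF gm fm] by simp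
      moreover have i2: "integrable \<mu> f" by (rule integrable_borel_probs[OF mu(1) f])
      moreover have "\<bar>(\<integral>x. f (g x) - f x \<partial>\<mu>)\<bar> \<le> e / 2"
      proof -
        have "norm (\<integral>x. f (g x) - f x \<partial>\<mu>) \<le> (\<integral>x. norm (f (g x) - f x) \<partial>\<mu>)"
          by (rule integral_norm_bound)
        also have "\<dots> \<le> (\<integral>x. e / 2 \<partial>\<mu>)"
        proof (rule integral_mono)
          show "norm (f (g x) - f x) \<le> e / 2" if "x \<in> space \<mu>" for x
            using that d(2)[of x "g x"] g gK
            by (fastforce simp: near_def space_borel_probs[OF mu(1)] dist_real_def)
        qed (use i1 i2 in auto)
        also have "\<dots> = e / 2" by (simp add: prob_space)
        finally show ?thesis by simp
      qed
      ultimately have "dist (\<integral>x. f x \<partial>\<mu>) (\<integral>x. f x \<partial>distr \<mu> ?S g) < e"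
        using e(1) by (simp add: dist_real_def abs_minus_commute)
      then show ?thesis using e(2) dg s by auto
    qed
    with d(1) show ?case by blast
  qed
  with assms(3) show thesis
    using that unfolding near_def by metis
qed

section \<open>Atomic measures parametrised by their atoms\<close>

abbreviation atoms_topology :: "'a::topological_space set \<Rightarrow> ('i \<Rightarrow> 'a) topology" where
  "atoms_topology K \<equiv> product_topology (\<lambda>_. top_of_set K) UNIV"

text \<open>The measure \<open>\<Sum>i. P(i) \<delta>\<^bsub>y i\<^esub>\<close>, for weights given by a probability mass function \<open>P\<close>.\<close>
definition atomic_measure :: "'a::topological_space set \<Rightarrow> 'i pmf \<Rightarrow> ('i \<Rightarrow> 'a) \<Rightarrow> 'a measure" where
  "atomic_measure K P y = distr (measure_pmf P) (restrict_space borel K) y"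

lemma measurable_atoms:
  "range y \<subseteq> K \<Longrightarrow> y \<in> measurable (measure_pmf P) (restrict_space borel K)"
  by (auto simp: measurable_def space_restrict_space)

lemma atomic_measure_borel_probs: "range y \<subseteq> K \<Longrightarrow> atomic_measure K P y \<in> borel_probs K"
  unfolding borel_probs_def atomic_measure_def
  by (auto intro!: measure_pmf.prob_space_distr measurable_atoms)

lemma measure_atomic_measure:
  assumes "range y \<subseteq> K" "K \<in> sets borel" "A \<in> sets borel" "A \<subseteq> K"
  shows "measure (atomic_measure K P y) A = measure P (y -` A)"
  unfolding atomic_measure_def
  by (subst measure_distr[OF measurable_atoms[OF assms(1)]]) (use assms in \<open>auto simp: sets_restrict_space_iff\<close>)

text \<open>The support of a probability mass function is countable, hence an increasing union of finite
  sets.\<close>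
lemma pmf_concentrated_on_finite:
  assumes "e > 0"
  obtains I where "finite I" "measure (measure_pmf P) I > 1 - e"
proof -
  let ?A = "\<lambda>n::nat. from_nat_into (set_pmf P) ` {..n}"
  have "(\<Union>n. ?A n) = range (from_nat_into (set_pmf P))" by auto
  also have "\<dots> = set_pmf P" by (simp add: range_from_nat_into set_pmf_not_empty)
  finally have U: "(\<Union>n. ?A n) = set_pmf P" .
  have "(\<lambda>n. measure P (?A n)) \<longlonglongrightarrow> measure P (\<Union>n. ?A n)"
    by (rule measure_pmf.finite_Lim_measure_incseq) (auto simp: incseq_def)
  moreover have "measure P (set_pmf P) = 1"
    by (simp add: measure_pmf.prob_eq_1 AE_measure_pmf)
  ultimately have "(\<lambda>n. measure P (?A n)) \<longlonglongrightarrow> 1" by (simp add: U)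
  then have "\<forall>\<^sub>F n in sequentially. measure P (?A n) > 1 - e"
    by (rule order_tendstoD) (use assms in simp)
  then obtain n where "measure P (?A n) > 1 - e"
    by (auto simp: eventually_sequentially)
  then show thesis
    using that[of "?A n"] by simp
qed


text \<open>The integral of a bounded continuous \<open>f\<close> is the series \<open>\<Sum>i. P(i) f(y i)\<close>, whose tails are small
  uniformly in \<open>y\<close>; up to a small error it depends continuously on finitely many atoms.\<close>
lemma continuous_map_atomic_measure:
  fixes K :: "'a::metric_space set"
  shows "continuous_map (atoms_topology K) (weak_topology K) (atomic_measure K P)"
  unfolding weak_topology_def
proof (rule continuous_on_generated_topo)
  let ?X = "atoms_topology K" and ?S = "restrict_space borel K :: 'a measure"
  have top: "topspace ?X = {y. range y \<subseteq> K}" by auto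
  fix O' assume "O' \<in> {{\<mu> \<in> borel_probs K. (\<integral>x. f x \<partial>\<mu>) \<in> U} | (f :: 'a \<Rightarrow> real) U.
        continuous_on K f \<and> bounded (f ` K) \<and> open U}"
  then obtain f :: "'a \<Rightarrow> real" and U where O': "O' = {\<mu> \<in> borel_probs K. (\<integral>x. f x \<partial>\<mu>) \<in> U}"
      and f: "continuous_on K f" "bounded (f ` K)" and U: "open U" by blast
  have fm: "f \<in> borel_measurable ?S"
    by (rule borel_measurable_continuous_on_restrict[OF f(1)])
  have int: "(\<integral>x. f x \<partial>atomic_measure K P y) = (\<integral>i. f (y i) \<partial>P)" if "range y \<subseteq> K" for y
    unfolding atomic_measure_def by (rule integral_distr[OF measurable_atoms[OF that] fm])
  obtain B where B: "B > 0" "\<And>x. x \<in> K \<Longrightarrow> \<bar>f x\<bar> \<le> B"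
    using f(2) by (auto simp: bounded_pos)
  have fi: "integrable P (\<lambda>i. f (y i))" if "range y \<subseteq> K" for y
    using that B(2) by (intro measure_pmf.integrable_const_bound[of _ B]) auto
  have "\<exists>T. openin ?X T \<and> y \<in> T \<and> T \<subseteq> atomic_measure K P -` O' \<inter> topspace ?X"
    if y: "y \<in> atomic_measure K P -` O' \<inter> topspace ?X" for y
  proof -
    have yK: "range y \<subseteq> K" using y by auto
    have "(\<integral>i. f (y i) \<partial>P) \<in> U" using y yK int by (auto simp: O')
    then obtain e where e: "e > 0" "ball (\<integral>i. f (y i) \<partial>P) e \<subseteq> U"
      using U open_contains_ball by blast
    \<comment> \<open>Outside \<open>I\<close> the values of \<open>f\<close> differ by at most \<open>2 * B\<close>, which contributes less than
      \<open>e / 2\<close> to the difference of the integrals.\<close>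
    obtain I where I: "finite I" "measure P I > 1 - e / (4 * B)"
      using pmf_concentrated_on_finite[of "e / (4 * B)" P] e B(1) by auto
    define V where "V i = {z \<in> topspace ?X. f (z i) \<in> ball (f (y i)) (e / 2)}" for i
    have V: "openin ?X (V i)" for i
    proof -
      have "continuous_map ?X euclideanreal (f \<circ> (\<lambda>z. z i))"
        using f(1) by (intro continuous_map_compose[of _ "top_of_set K"] continuous_map_product_coordinates) auto
      then show ?thesis
        unfolding V_def using openin_continuous_map_preimage[of ?X euclideanreal "f \<circ> (\<lambda>z. z i)"
            "ball (f (y i)) (e / 2)"]
        by (simp add: o_def)
    qed
    have "z \<in> atomic_measure K P -` O' \<inter> topspace ?X" if z: "z \<in> (\<Inter>i\<in>I. V i) \<inter> topspace ?X" for z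
    proof -
      have zK: "range z \<subseteq> K" using z by auto
      have "\<bar>(\<integral>i. f (y i) - f (z i) \<partial>P)\<bar> \<le> (\<integral>i. \<bar>f (y i) - f (z i)\<bar> \<partial>P)"
        by (rule integral_abs_bound)
      also have "\<dots> \<le> (\<integral>i. e / 2 + 2 * B * indicator (- I) i \<partial>P)"
      proof (rule integral_mono)
        show "\<bar>f (y i) - f (z i)\<bar> \<le> e / 2 + 2 * B * indicator (- I) i" for i
        proof (cases "i \<in> I")
          case True
          then show ?thesis using z by (auto simp: V_def dist_real_def)
        next
          case False
          have "\<bar>f (y i)\<bar> \<le> B" "\<bar>f (z i)\<bar> \<le> B" using B(2)[of "y i"] B(2)[of "z i"] yK zK by auto
          then show ?thesis using False e(1) by simp
        qed
      qed (use fi[OF yK] fi[OF zK] in \<open>auto intro!: measure_pmf.integrable_const_bound[of _ "e / 2 + 2 * B"]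
              simp: indicator_def B(1) e(1) less_imp_le\<close>)
      also have "\<dots> = e / 2 + 2 * B * measure P (- I)"
        by (subst Bochner_Integration.integral_add) (auto simp: measure_pmf.emeasure_eq_measure)
      also have "measure P (- I) = 1 - measure P I"
        using measure_pmf.prob_compl[of I P] by (simp add: Compl_eq_Diff_UNIV)
      also have "e / 2 + 2 * B * (1 - measure P I) < e"
        using I(2) B(1) by (simp add: field_simps)
      finally have "(\<integral>i. f (z i) \<partial>P) \<in> ball (\<integral>i. f (y i) \<partial>P) e"
        using fi[OF yK] fi[OF zK] by (simp add: dist_real_def)
      then show ?thesis
        using e(2) zK by (auto simp: O' int atomic_measure_borel_probs)
    qed
    moreover have "y \<in> (\<Inter>i\<in>I. V i) \<inter> topspace ?X"
      using y e(1) by (auto simp: V_def)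
    moreover have "openin ?X ((\<Inter>i\<in>I. V i) \<inter> topspace ?X)"
      using I(1) V by (intro openin_INT) auto
    ultimately show ?thesis by blast
  qed
  then show "openin ?X (atomic_measure K P -` O' \<inter> topspace ?X)"
    by (subst openin_subopen) blast
next
  have "borel_probs K \<in> {{\<mu> \<in> borel_probs K. (\<integral>x. f x \<partial>\<mu>) \<in> U} | (f :: 'a \<Rightarrow> real) U.
        continuous_on K f \<and> bounded (f ` K) \<and> open U}"
    by (rule CollectI, rule exI[of _ "\<lambda>_. 0"], rule exI[of _ UNIV]) (auto simp: image_def)
  moreover have "atomic_measure K P ` topspace (atoms_topology K) \<subseteq> borel_probs K"
    by (auto intro!: atomic_measure_borel_probs)
  ultimately show "atomic_measure K P ` topspace (atoms_topology K) \<subseteq>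
     \<Union> {{\<mu> \<in> borel_probs K. (\<integral>x. f x \<partial>\<mu>) \<in> U} | (f :: 'a \<Rightarrow> real) U.
        continuous_on K f \<and> bounded (f ` K) \<and> open U}" by blast
qed

text \<open>Every law on \<open>K\<close> is approximated by its push-forward under a map onto a sequence of points
  that moves points by little. Splitting each atom into infinitely many atoms at the same point
  gives the weights infinite support without changing the measure.\<close>
lemma atomic_measures_weakly_dense:
  fixes K :: "'a::{metric_space, second_countable_topology} set"
  assumes "compact K" "openin (weak_topology K) W" "W \<noteq> {}"
  obtains P :: "(nat \<times> nat) pmf" and y where "infinite (set_pmf P)" "range y \<subseteq> K"
    "atomic_measure K P y \<in> W"
proof -
  let ?S = "restrict_space borel K :: 'a measure" and ?N = "count_space UNIV :: nat measure"
  obtain \<mu> where mu: "\<mu> \<in> W" using assms(3) by auto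
  then have bp: "\<mu> \<in> borel_probs K"
    using openin_subset[OF assms(2)] by (auto simp: topspace_weak_topology)
  interpret prob_space \<mu> using bp by (simp add: borel_probs_def)
  have sets_mu: "sets \<mu> = sets ?S" using bp by (simp add: borel_probs_def)
  have "K \<noteq> {}" using not_empty space_borel_probs[OF bp] by simp
  obtain \<delta> where \<delta>: "\<delta> > 0" and close:
    "\<And>g. g \<in> measurable ?S ?S \<Longrightarrow> (\<And>x. x \<in> K \<Longrightarrow> dist (g x) x < \<delta>) \<Longrightarrow> distr \<mu> ?S g \<in> W"
    using weak_open_contains_small_displacements[OF assms(1,2) mu] by metis
  obtain D where D: "countable D" "D \<subseteq> K" "K \<subseteq> closure D" using separable by metis
  have "D \<noteq> {}" using D(3) \<open>K \<noteq> {}\<close> by auto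
  define d where "d = from_nat_into D"
  have dK: "d i \<in> K" for i using from_nat_into[OF \<open>D \<noteq> {}\<close>] D(2) by (auto simp: d_def)
  have ex: "\<exists>i. dist (d i) x < \<delta>" if "x \<in> K" for x
  proof -
    have "x \<in> closure D" using that D(3) by blast
    then have "\<exists>z\<in>D. dist z x < \<delta>"
      using \<delta> by (simp add: closure_approachable)
    then obtain z where "z \<in> D" "dist z x < \<delta>" by blast
    then show ?thesis using from_nat_into_surj[OF D(1)] by (metis d_def)
  qed
  \<comment> \<open>The least index makes the choice of a nearby point of the sequence measurable.\<close>
  define n where "n x = (LEAST i. dist (d i) x < \<delta>)" for x
  have n: "dist (d (n x)) x < \<delta>" if "x \<in> K" for x
    unfolding n_def by (rule LeastI_ex[OF ex[OF that]])
  have nm: "n \<in> measurable ?S ?N"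
    unfolding n_def by (intro measurable_Least measurable_restrict_space1) measurable
  have dm: "d \<in> measurable ?N ?S"
    using dK by (auto simp: measurable_def space_restrict_space)
  have nm': "n \<in> measurable \<mu> ?N" using nm sets_mu measurable_cong_sets by blast
  interpret Q: prob_space "distr \<mu> ?N n" by (rule prob_space_distr[OF nm'])
  have "AE i in distr \<mu> ?N n. measure (distr \<mu> ?N n) {i} \<noteq> 0"
    by (subst Q.AE_support_countable) (auto intro!: exI[of _ UNIV])
  then have "distr \<mu> ?N n \<in> {M. prob_space M \<and> sets M = UNIV \<and> (AE x in M. measure M {x} \<noteq> 0)}"
    using Q.prob_space_axioms by simp
  then have "measure_pmf (Abs_pmf (distr \<mu> ?N n)) = distr \<mu> ?N n"
    by (rule Abs_pmf_inverse)
  then obtain q where q: "measure_pmf q = distr \<mu> ?N n" by blast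
  define P where "P = pair_pmf q (geometric_pmf (1/2))"
  have "infinite (set_pmf P)"
    using set_pmf_not_empty[of q] by (auto simp: P_def set_pmf_geometric finite_cartesian_product_iff)
  moreover have "range (d \<circ> fst) \<subseteq> K" using dK by auto
  moreover have "atomic_measure K P (d \<circ> fst) = distr \<mu> ?S (d \<circ> n)"
  proof -
    have "distr \<mu> ?S (d \<circ> n) = distr (measure_pmf q) ?S d"
      unfolding q by (rule distr_distr[OF dm nm', symmetric])
    also have "measure_pmf q = distr (measure_pmf P) ?N fst"
    proof -
      have "q = map_pmf fst P" by (simp add: P_def map_fst_pair_pmf)
      then show ?thesis by (simp add: map_pmf_rep_eq)
    qed
    also have "distr \<dots> ?S d = distr (measure_pmf P) ?S (d \<circ> fst)"
      by (rule distr_distr[OF dm]) simp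
    finally show ?thesis unfolding atomic_measure_def by (rule sym)
  qed
  moreover have "distr \<mu> ?S (d \<circ> n) \<in> W"
    using n by (intro close measurable_comp[OF nm dm]) auto
  ultimately show thesis using that[of P "d \<circ> fst"] by simp
qed

lemma atoms_topology_open_contains:
  fixes K :: "'a::metric_space set"
  assumes "openin (atoms_topology K) T" "y \<in> T"
  obtains J \<rho> where "finite J" "\<rho> > 0"
    "\<And>x. range x \<subseteq> K \<Longrightarrow> (\<And>i. i \<in> J \<Longrightarrow> dist (x i) (y i) < \<rho>) \<Longrightarrow> x \<in> T"
proof -
  obtain X where X: "y \<in> (\<Pi>\<^sub>E i\<in>UNIV. X i)" "\<And>i. openin (top_of_set K) (X i)"
     "finite {i. X i \<noteq> topspace (top_of_set K)}" "(\<Pi>\<^sub>E i\<in>UNIV. X i) \<subseteq> T"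
    using product_topology_open_contains_basis[OF assms] by auto
  define J where "J = {i. X i \<noteq> K}"
  have J: "finite J" using X(3) by (simp add: J_def)
  have "\<exists>e>0. \<forall>x\<in>K. dist x (y i) < e \<longrightarrow> x \<in> X i" for i
  proof -
    have "y i \<in> X i" using X(1) by (simp add: PiE_iff)
    then show ?thesis using X(2)[of i] by (simp add: openin_euclidean_subtopology_iff)
  qed
  then obtain e where e: "\<And>i. e i > 0" "\<And>i x. x \<in> K \<Longrightarrow> dist x (y i) < e i \<Longrightarrow> x \<in> X i"
    by metis
  define \<rho> where "\<rho> = Min (insert 1 (e ` J))"
  have "\<rho> > 0" using J e(1) by (auto simp: \<rho>_def)
  have "\<rho> \<le> e i" if "i \<in> J" for i using that J by (simp add: \<rho>_def)
  then have "x \<in> T" if "range x \<subseteq> K" "\<And>i. i \<in> J \<Longrightarrow> dist (x i) (y i) < \<rho>" for x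
  proof -
    have "x i \<in> X i" for i
      using that e(2)[of "x i" i] \<open>\<And>i. i \<in> J \<Longrightarrow> \<rho> \<le> e i\<close>[of i] 
      by (cases "i \<in> J") (force simp: J_def)+
    then show ?thesis using X(4) by auto
  qed
  with J \<open>\<rho> > 0\<close> show thesis using that by blast
qed

text \<open>The Baire category theorem is applied not in \<open>\<P>(K)\<close> but in the compact product of copies of
  \<open>K\<close>: for fixed weights the preimages of the given sets are open and dense there, so a weakly
  open set that contains one atomic measure contains another one, with the same weights, lying in
  all the given sets.\<close>
lemma typical_if_dense_among_atomic:
  fixes K :: "'a::{metric_space, second_countable_topology} set"
  assumes "compact K" "countable \<O>"
    and op: "\<And>V. V \<in> \<O> \<Longrightarrow> openin (weak_topology K) V"
    and dense: "\<And>V P T. V \<in> \<O> \<Longrightarrow> infinite (set_pmf (P :: (nat \<times> nat) pmf)) \<Longrightarrow>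
      openin (atoms_topology K) T \<Longrightarrow> T \<noteq> {} \<Longrightarrow> \<exists>y\<in>T. atomic_measure K P y \<in> V"
  shows "typical K (\<lambda>\<mu>. \<mu> \<in> borel_probs K \<and> (\<forall>V\<in>\<O>. \<mu> \<in> V))"
proof -
  let ?W = "weak_topology K"
  define G where "G = \<Inter> (insert (topspace ?W) \<O>)"
  have "gdelta_in ?W G"
    unfolding G_def using assms(2) op by (intro gdelta_in_Inter) (auto intro: open_imp_gdelta_in)
  moreover have "G \<inter> U \<noteq> {}" if U: "openin ?W U" "U \<noteq> {}" for U
  proof -
    obtain P :: "(nat \<times> nat) pmf" and y where P: "infinite (set_pmf P)" "range y \<subseteq> K"
      "atomic_measure K P y \<in> U"
      using atomic_measures_weakly_dense[OF assms(1) U] by metis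
    let ?X = "atoms_topology K :: (nat \<times> nat \<Rightarrow> 'a) topology"
    define pre where "pre V = {z \<in> topspace ?X. atomic_measure K P z \<in> V}" for V
    have pre_open: "openin ?X (pre V)" if "openin ?W V" for V
      unfolding pre_def by (rule openin_continuous_map_preimage[OF continuous_map_atomic_measure that])
    have cpt: "compact_space ?X"
      using assms(1) by (simp add: compact_space_product_topology compact_space_subtopology)
    have haus: "Hausdorff_space ?X"
      by (simp add: Hausdorff_space_product_topology Hausdorff_space_subtopology)
    have "?X closure_of \<Inter> (pre ` \<O>) = topspace ?X"
    proof (rule Baire_category)
      show "completely_metrizable_space ?X \<or> locally_compact_space ?X \<and> regular_space ?X"
        using cpt haus compact_Hausdorff_imp_regular_space compact_imp_locally_compact_space by blast
      show "countable (pre ` \<O>)" using assms(2) by simp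
      fix T assume "T \<in> pre ` \<O>"
      then obtain V where V: "V \<in> \<O>" "T = pre V" by auto
      have "pre V \<inter> T' \<noteq> {}" if T': "openin ?X T'" "T' \<noteq> {}" for T'
      proof -
        obtain z where "z \<in> T'" "atomic_measure K P z \<in> V"
          using dense[OF V(1) P(1) T'] by blast
        then have "z \<in> pre V \<inter> T'"
          using openin_subset[OF T'(1)] unfolding pre_def by blast
        then show ?thesis by blast
      qed
      then have "?X closure_of pre V = topspace ?X"
        unfolding dense_intersects_open by blast
      then show "openin ?X T \<and> ?X closure_of T = topspace ?X"
        using pre_open[OF op[OF V(1)]] V(2) by simp
    qed
    moreover have "y \<in> pre U" using P by (auto simp: pre_def)
    ultimately have "\<Inter> (pre ` \<O>) \<inter> pre U \<noteq> {}"
      using pre_open[OF U(1)] unfolding dense_intersects_open by blast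
    then obtain z where z: "z \<in> pre U" "z \<in> \<Inter> (pre ` \<O>)" by blast
    then have "atomic_measure K P z \<in> topspace ?W"
      using openin_subset[OF U(1)] by (auto simp: pre_def)
    then show ?thesis using z by (auto simp: G_def pre_def)
  qed
  then have "?W closure_of G = topspace ?W"
    unfolding dense_intersects_open by blast
  ultimately show ?thesis
    unfolding typical_def by (intro exI[of _ G]) (simp add: G_def topspace_weak_topology)
qed


section \<open>Typical measures sit on few balls of prescribed type\<close>

text \<open>Near any finitely many points there are points of type \<open>Q\<close>, at a common scale as small as
  desired. The scale may depend on the points: this is what a lower limit, or the negation of an
  upper one, provides.\<close>
definition attained_nearby :: "'a::metric_space set \<Rightarrow> (real \<Rightarrow> 'a \<Rightarrow> bool) \<Rightarrow> bool" where
  "attained_nearby K Q \<longleftrightarrow> (\<forall>F \<rho> \<delta>. finite F \<and> F \<subseteq> K \<and> 0 < \<rho> \<and> 0 < \<delta> \<longrightarrow>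
     (\<exists>r. 0 < r \<and> r < \<delta> \<and> (\<forall>y\<in>F. \<exists>x\<in>K. dist x y < \<rho> \<and> Q r x)))"

text \<open>The bound on the number of centres makes it negligible on the logarithmic scale as \<open>n\<close>
  grows.\<close>
definition few_centres ::
  "'a::metric_space set \<Rightarrow> (real \<Rightarrow> 'a \<Rightarrow> bool) \<Rightarrow> nat \<Rightarrow> real \<Rightarrow> 'a set \<Rightarrow> bool" where
  "few_centres K Q n r F \<longleftrightarrow> 0 < r \<and> r < 1 / real (Suc n) \<and> finite F \<and> F \<subseteq> K \<and>
     real (card F) \<le> r powr - (1 / real (Suc n)) \<and> (\<forall>x\<in>F. Q r x)"

text \<open>The exceptional masses are summable in \<open>n\<close>, so that intersecting the sets for all large \<open>n\<close>
  still leaves nearly full measure.\<close>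
definition concentrated :: "'a::metric_space set \<Rightarrow> (real \<Rightarrow> 'a \<Rightarrow> bool) \<Rightarrow> 'a measure \<Rightarrow> bool" where
  "concentrated K Q \<mu> \<longleftrightarrow> (\<forall>n. \<exists>r F. few_centres K Q n r F \<and>
     1 - (1/2) ^ n < measure \<mu> ((\<Union>x\<in>F. ball x r) \<inter> K))"

definition full_support_on :: "'a::topological_space set \<Rightarrow> 'a measure \<Rightarrow> bool" where
  "full_support_on K \<mu> \<longleftrightarrow> (\<forall>V. open V \<and> V \<inter> K \<noteq> {} \<longrightarrow> 0 < measure \<mu> (V \<inter> K))"

text \<open>An open set of families of atoms restricts only finitely many of them. As infinitely many
  atoms have positive weight, one of the unrestricted ones can be moved into \<open>V\<close>.\<close>
lemma atomic_full_support_dense: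
  fixes K :: "'a::metric_space set"
  assumes "K \<in> sets borel" "open V" "V \<inter> K \<noteq> {}" "infinite (set_pmf P)"
    "openin (atoms_topology K) T" "T \<noteq> {}"
  shows "\<exists>y\<in>T. 0 < measure (atomic_measure K P y) (V \<inter> K)"
proof -
  obtain y where y: "y \<in> T" using assms(6) by auto
  have yK: "range y \<subseteq> K" using y openin_subset[OF assms(5)] by auto
  obtain J \<rho> where J: "finite J" "\<rho> > 0"
    "\<And>x. range x \<subseteq> K \<Longrightarrow> (\<And>i. i \<in> J \<Longrightarrow> dist (x i) (y i) < \<rho>) \<Longrightarrow> x \<in> T"
    using atoms_topology_open_contains[OF assms(5) y] by metis
  obtain i where i: "i \<in> set_pmf P" "i \<notin> J"
    using assms(4) J(1) by (meson finite_subset subsetI)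
  obtain v where v: "v \<in> V" "v \<in> K" using assms(3) by auto
  have xK: "range (y(i := v)) \<subseteq> K" using yK v by auto
  then have "y(i := v) \<in> T" using J(2) i by (intro J(3)) auto
  moreover have "0 < measure P {i}" using i by (simp add: measure_pmf_single pmf_positive)
  then have "0 < measure P (y(i := v) -` (V \<inter> K))"
    by (rule order_less_le_trans) (use v in \<open>auto intro!: measure_pmf.finite_measure_mono\<close>)
  then have "0 < measure (atomic_measure K P (y(i := v))) (V \<inter> K)"
    using assms(1,2) by (subst measure_atomic_measure[OF xK]) auto
  ultimately show ?thesis by blast
qed

text \<open>All but \<open>(1/2)\<^sup>n\<close> of the mass is carried by finitely many atoms. These can be moved slightly
  onto points of type \<open>Q\<close> at a scale \<open>r\<close> as small as desired; as their number is chosen before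
  \<open>r\<close>, it is at most a small negative power of \<open>r\<close>.\<close>
lemma atomic_concentrated_dense:
  fixes K :: "'a::metric_space set"
  assumes "K \<in> sets borel" "attained_nearby K Q"
    "openin (atoms_topology K) T" "T \<noteq> {}"
  shows "\<exists>y\<in>T. \<exists>r F. few_centres K Q n r F \<and>
     1 - (1/2) ^ n < measure (atomic_measure K P y) ((\<Union>x\<in>F. ball x r) \<inter> K)"
proof -
  obtain y where y: "y \<in> T" using assms(4) by auto
  have yK: "range y \<subseteq> K" using y openin_subset[OF assms(3)] by auto
  obtain J \<rho> where J: "finite J" "\<rho> > 0"
    "\<And>x. range x \<subseteq> K \<Longrightarrow> (\<And>i. i \<in> J \<Longrightarrow> dist (x i) (y i) < \<rho>) \<Longrightarrow> x \<in> T"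
    using atoms_topology_open_contains[OF assms(3) y] by metis
  obtain I where I: "finite I" "measure P I > 1 - (1/2) ^ n"
    using pmf_concentrated_on_finite[of "(1/2) ^ n" P] by auto
  define c where "c = real (card I) + 1"
  \<comment> \<open>For \<open>r \<le> a\<close> one has \<open>c \<le> r powr - (1 / real (Suc n))\<close>.\<close>
  define a where "a = c powr - real (Suc n)"
  have c: "c > 0" by (simp add: c_def)
  then have a: "a > 0" by (simp add: a_def)
  obtain r where r: "0 < r" "r < min (1 / real (Suc n)) a"
    "\<And>z. z \<in> y ` I \<Longrightarrow> \<exists>x\<in>K. dist x z < \<rho> \<and> Q r x"
  proof -
    have "finite (y ` I)" "y ` I \<subseteq> K" "0 < min (1 / real (Suc n)) a" using I yK a by auto
    then show thesis
      using assms(2) J(2) that unfolding attained_nearby_def by meson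
  qed
  then obtain \<xi> where \<xi>: "\<And>z. z \<in> y ` I \<Longrightarrow> \<xi> z \<in> K \<and> dist (\<xi> z) z < \<rho> \<and> Q r (\<xi> z)"
    by metis
  define x where "x i = (if i \<in> I then \<xi> (y i) else y i)" for i
  define F where "F = \<xi> ` y ` I"
  have xK: "range x \<subseteq> K" using \<xi> yK by (auto simp: x_def)
  have "x \<in> T"
    using xK \<xi> J(2) by (intro J(3)) (auto simp: x_def)
  moreover have "few_centres K Q n r F"
  proof -
    have "real (card F) \<le> c"
      using card_image_le[of "y ` I" \<xi>] card_image_le[of I y] I(1) by (simp add: F_def c_def)
    also have "c = a powr - (1 / real (Suc n))"
    proof -
      have "- real (Suc n) * - (1 / real (Suc n)) = 1" by (simp del: of_nat_Suc)
      then show ?thesis using c by (simp only: a_def powr_powr) simp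
    qed
    also have "\<dots> \<le> r powr - (1 / real (Suc n))"
      using r by (intro powr_mono2') auto
    finally show ?thesis
      using r \<xi> I(1) by (auto simp: few_centres_def F_def)
  qed
  moreover have "1 - (1/2) ^ n < measure (atomic_measure K P x) ((\<Union>x\<in>F. ball x r) \<inter> K)"
  proof -
    have "(\<Union>x\<in>F. ball x r) \<inter> K \<in> sets borel"
      by (intro sets.Int[OF borel_open assms(1)] open_UN) auto
    then have "measure (atomic_measure K P x) ((\<Union>x\<in>F. ball x r) \<inter> K)
        = measure P (x -` ((\<Union>x\<in>F. ball x r) \<inter> K))"
      by (intro measure_atomic_measure xK assms(1)) auto
    also have "\<dots> \<ge> measure P I"
    proof (rule measure_pmf.finite_measure_mono)
      show "I \<subseteq> x -` ((\<Union>x\<in>F. ball x r) \<inter> K)"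
      proof
        fix i assume "i \<in> I"
        then have "x i \<in> F" by (auto simp: F_def x_def)
        moreover have "x i \<in> ball (x i) r" using r(1) by simp
        moreover have "x i \<in> K" using xK by auto
        ultimately show "i \<in> x -` ((\<Union>x\<in>F. ball x r) \<inter> K)" by blast
      qed
    qed simp
    finally show ?thesis using I(2) by simp
  qed
  ultimately show ?thesis by blast
qed

text \<open>Only a countable base has to be charged, and concentration for \<open>Q\<close> is the intersection over
  \<open>n\<close> of unions of weakly open sets; together these are countably many open conditions.\<close>
proposition typical_full_support_concentrated:
  fixes K :: "'a::{metric_space, second_countable_topology} set"
  assumes "compact K" "countable \<Q>" "\<And>Q. Q \<in> \<Q> \<Longrightarrow> attained_nearby K Q"
  shows "typical K (\<lambda>\<mu>. \<mu> \<in> borel_probs K \<and> full_support_on K \<mu> \<and> (\<forall>Q\<in>\<Q>. concentrated K Q \<mu>))"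
proof -
  have K: "K \<in> sets borel" using assms(1) by (simp add: compact_imp_closed)
  obtain \<B> :: "'a set set" where \<B>: "countable \<B>" "topological_basis \<B>"
    using ex_countable_basis by blast
  define charging where "charging V = {\<mu> \<in> borel_probs K. 0 < measure \<mu> (V \<inter> K)}" for V
  define conc where "conc Q n = {\<mu> \<in> borel_probs K. \<exists>r F. few_centres K Q n r F \<and>
     1 - (1/2) ^ n < measure \<mu> ((\<Union>x\<in>F. ball x r) \<inter> K)}" for Q n
  define \<O> where "\<O> = charging ` {V \<in> \<B>. V \<inter> K \<noteq> {}} \<union> (\<lambda>(Q, n). conc Q n) ` (\<Q> \<times> UNIV)"
  have "typical K (\<lambda>\<mu>. \<mu> \<in> borel_probs K \<and> (\<forall>V\<in>\<O>. \<mu> \<in> V))"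
  proof (rule typical_if_dense_among_atomic)
    show "countable \<O>" unfolding \<O>_def using \<B>(1) assms(2) by auto
  next
    fix V assume "V \<in> \<O>"
    then consider (1) V' where "V = charging V'" "V' \<in> \<B>" | (2) Q n where "V = conc Q n"
      by (auto simp: \<O>_def)
    then show "openin (weak_topology K) V"
    proof cases
      case 1
      then show ?thesis
        unfolding 1(1) charging_def using topological_basis_open[OF \<B>(2)]
        by (intro openin_weak_measure_greater K) auto
    next
      case 2
      have "conc Q n = \<Union> {{\<mu> \<in> borel_probs K. 1 - (1/2) ^ n < measure \<mu> ((\<Union>x\<in>F. ball x r) \<inter> K)} |
          r F. few_centres K Q n r F}" by (auto simp: conc_def)
      also have "openin (weak_topology K) \<dots>"
        by (rule openin_Union) (auto intro!: openin_weak_measure_greater K)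
      finally show ?thesis using 2 by simp
    qed
  next
    fix V and P :: "(nat \<times> nat) pmf" and T :: "(nat \<times> nat \<Rightarrow> 'a) set"
    assume V: "V \<in> \<O>" and P: "infinite (set_pmf P)" and T: "openin (atoms_topology K) T" "T \<noteq> {}"
    have bp: "atomic_measure K P y \<in> borel_probs K" if "y \<in> T" for y
      using that openin_subset[OF T(1)] by (intro atomic_measure_borel_probs) auto
    from V consider (1) V' where "V = charging V'" "V' \<in> \<B>" "V' \<inter> K \<noteq> {}"
      | (2) Q n where "V = conc Q n" "Q \<in> \<Q>"
      by (auto simp: \<O>_def)
    then show "\<exists>y\<in>T. atomic_measure K P y \<in> V"
    proof cases
      case 1
      then show ?thesis
        using atomic_full_support_dense[OF K _ 1(3) P T] topological_basis_open[OF \<B>(2)] bp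
        by (auto simp: charging_def)
    next
      case 2
      then show ?thesis
        using atomic_concentrated_dense[OF K assms(3)[OF 2(2)] T, of n P] bp
        by (auto simp: conc_def)
    qed
  qed (rule assms(1))
  then obtain G where G: "gdelta_in (weak_topology K) G"
    "weak_topology K closure_of G = topspace (weak_topology K)"
    "\<And>\<mu>. \<mu> \<in> G \<Longrightarrow> \<mu> \<in> borel_probs K \<and> (\<forall>V\<in>\<O>. \<mu> \<in> V)"
    unfolding typical_def by blast
  have "full_support_on K \<mu> \<and> (\<forall>Q\<in>\<Q>. concentrated K Q \<mu>)" if \<mu>: "\<mu> \<in> G" for \<mu>
  proof (intro conjI ballI)
    interpret prob_space \<mu> using G(3)[OF \<mu>] by (simp add: borel_probs_def)
    show "full_support_on K \<mu>"
      unfolding full_support_on_def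
    proof (intro allI impI)
      fix V assume V: "open V \<and> V \<inter> K \<noteq> {}"
      then obtain v where "v \<in> V" "v \<in> K" by auto
      then obtain V' where V': "V' \<in> \<B>" "v \<in> V'" "V' \<subseteq> V"
        using V topological_basisE[OF \<B>(2)] by metis
      then have "charging V' \<in> \<O>" using \<open>v \<in> K\<close> by (auto simp: \<O>_def)
      then have "0 < measure \<mu> (V' \<inter> K)"
        using G(3)[OF \<mu>] by (auto simp: charging_def)
      also have "\<dots> \<le> measure \<mu> (V \<inter> K)"
        using V V'(3) K G(3)[OF \<mu>] by (intro finite_measure_mono) (auto simp: sets_borel_probs)
      finally show "0 < measure \<mu> (V \<inter> K)" .
    qed
    fix Q assume "Q \<in> \<Q>"
    then have "conc Q n \<in> \<O>" for n by (force simp: \<O>_def)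
    then have "\<mu> \<in> conc Q n" for n using G(3)[OF \<mu>] by blast
    then show "concentrated K Q \<mu>" by (simp add: conc_def concentrated_def)
  qed
  with G show ?thesis unfolding typical_def by blast
qed

section \<open>Covering numbers and dimensions\<close>

lemma eln_mono: "a \<le> b \<Longrightarrow> eln a \<le> eln b"
  by (cases a; cases b) (auto simp: eln_def top_unique)

lemma eln_powr: "0 < r \<Longrightarrow> eln (ennreal (r powr c)) = ereal (c * ln r)"
  by (simp add: eln_def ln_powr)

lemma ereal_divide_minus_right: "L < 0 \<Longrightarrow> a / ereal L = - (a / ereal (- L))"
  by (cases a) auto

text \<open>In the following estimates \<open>m\<close> is compared with a power of \<open>r < 1\<close>. Dividing logarithms by
  \<open>- ln r > 0\<close>, as in the box dimension, preserves the comparison and negates the exponent;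
  dividing by \<open>ln r < 0\<close>, as in the uniform dimensions, reverses it and keeps the exponent.\<close>
lemma eln_quotient_le:
  assumes "0 < r" "r < 1" "m \<le> ennreal (r powr c)"
  shows "eln m / ereal (- ln r) \<le> ereal (- c)"
proof -
  have L: "ln r < 0" using assms by simp
  have "eln m / ereal (- ln r) \<le> ereal (c * ln r) / ereal (- ln r)"
    using eln_mono[OF assms(3)] assms(1) L by (intro ereal_divide_right_mono) (auto simp: eln_powr)
  also have "\<dots> = ereal (- c)" using L by simp
  finally show ?thesis .
qed

lemma eln_quotient_ge:
  assumes "0 < r" "r < 1" "ennreal (r powr c) \<le> m"
  shows "ereal (- c) \<le> eln m / ereal (- ln r)"
proof -
  have L: "ln r < 0" using assms by simp
  have "ereal (- c) = ereal (c * ln r) / ereal (- ln r)" using L by simp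
  also have "\<dots> \<le> eln m / ereal (- ln r)"
    using eln_mono[OF assms(3)] assms(1) L by (intro ereal_divide_right_mono) (auto simp: eln_powr)
  finally show ?thesis .
qed

lemma eln_ratio_ge:
  assumes "0 < r" "r < 1" "m \<le> ennreal (r powr c)"
  shows "ereal c \<le> eln m / ereal (ln r)"
proof -
  have "ereal c = - ereal (- c)" by simp
  also have "\<dots> \<le> - (eln m / ereal (- ln r))"
    using eln_quotient_le[OF assms] by (simp only: ereal_minus_le_minus)
  also have "\<dots> = eln m / ereal (ln r)"
    using assms(1,2) by (intro ereal_divide_minus_right[symmetric]) simp
  finally show ?thesis .
qed

lemma eln_ratio_le:
  assumes "0 < r" "r < 1" "ennreal (r powr c) \<le> m"
  shows "eln m / ereal (ln r) \<le> ereal c"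
proof -
  have "eln m / ereal (ln r) = - (eln m / ereal (- ln r))"
    using assms(1,2) by (intro ereal_divide_minus_right) simp
  also have "\<dots> \<le> - ereal (- c)"
    using eln_quotient_ge[OF assms] by (simp only: ereal_minus_le_minus)
  finally show ?thesis by simp
qed

lemma cov_num_le:
  assumes "finite F" "F \<subseteq> K" "E \<subseteq> (\<Union>x\<in>F. ball x r)" "0 \<le> b"
    "\<And>x. x \<in> F \<Longrightarrow> measure \<pi> (ball x r) powr q \<le> b"
  shows "cov_num \<pi> K q E r \<le> ennreal (real (card F) * b)"
proof -
  obtain h where h: "bij_betw h {0..<card F} F"
    using ex_bij_betw_nat_finite[OF assms(1)] by auto
  then have im: "h ` {0..<card F} = F" by (simp add: bij_betw_def)
  have cover: "E \<subseteq> (\<Union>i\<in>{0..<card F}. ball (h i) r)"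
  proof -
    have "(\<Union>i\<in>{0..<card F}. ball (h i) r) = (\<Union>x\<in>h ` {0..<card F}. ball x r)" by simp
    then show ?thesis using assms(3) by (simp only: im)
  qed
  have "cov_num \<pi> K q E r \<le> (\<Sum>\<^sub>\<infinity>i\<in>{0..<card F}. ennreal (measure \<pi> (ball (h i) r) powr q))"
    unfolding cov_num_def using assms(2) cover im
    by (intro INF_lower2[of "({0..<card F}, h)"]) auto
  also have "\<dots> = (\<Sum>i\<in>{0..<card F}. ennreal (measure \<pi> (ball (h i) r) powr q))"
    by (rule infsum_finite) simp
  also have "\<dots> = ennreal (\<Sum>i\<in>{0..<card F}. measure \<pi> (ball (h i) r) powr q)"
    by (simp add: sum_ennreal)
  also have "\<dots> \<le> ennreal (\<Sum>i\<in>{0..<card F}. b)"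
    using im by (intro ennreal_leI sum_mono assms(5)) auto
  finally show ?thesis by simp
qed

lemma cov_num_ge:
  assumes "e \<in> E" "\<And>x. x \<in> K \<Longrightarrow> dist x e < r \<Longrightarrow> b \<le> measure \<pi> (ball x r) powr q"
  shows "ennreal b \<le> cov_num \<pi> K q E r"
  unfolding cov_num_def
proof (rule INF_greatest, clarify)
  fix I :: "nat set" and x assume x: "x ` I \<subseteq> K" "E \<subseteq> (\<Union>i\<in>I. ball (x i) r)"
  let ?t = "\<lambda>i. ennreal (measure \<pi> (ball (x i) r) powr q)"
  obtain i where i: "i \<in> I" "dist (x i) e < r" using x(2) assms(1) by auto
  have "ennreal b \<le> ?t i" using i x(1) by (intro ennreal_leI assms(2)) auto
  also have "\<dots> = infsum ?t {i}" by simp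
  also have "\<dots> \<le> infsum ?t I"
    using i(1) by (intro infsum_mono_neutral nonneg_summable_on_complete) auto
  finally show "ennreal b \<le> infsum ?t I" .
qed

lemma Lim_at_right_0_antimono:
  fixes f :: "real \<Rightarrow> ereal"
  assumes "\<And>x y. 0 < x \<Longrightarrow> x \<le> y \<Longrightarrow> f y \<le> f x"
  shows "Lim (at_right 0) f = (SUP x\<in>{0<..}. f x)"
proof (rule tendsto_Lim)
  show "(f \<longlongrightarrow> (SUP x\<in>{0<..}. f x)) (at_right 0)"
  proof (rule order_tendstoI)
    fix a assume "a < (SUP x\<in>{0<..}. f x)"
    then obtain x where x: "x > 0" "a < f x" by (auto simp: less_SUP_iff)
    then have "a < f y" if "0 < y" "y < x" for y
      using assms[of y x] that by (auto intro: order_less_le_trans)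
    then show "\<forall>\<^sub>F y in at_right 0. a < f y"
      using x(1) by (auto simp: eventually_at_right_field)
  next
    fix a assume a: "(SUP x\<in>{0<..}. f x) < a"
    have "f y < a" if "0 < y" for y
      by (rule le_less_trans[OF _ a]) (use that in \<open>auto intro: SUP_upper\<close>)
    then show "\<forall>\<^sub>F y in at_right 0. f y < a"
      by (auto simp: eventually_at_right_field intro!: exI[of _ 1])
  qed
qed simp

text \<open>The infimum runs over fewer sets as \<open>\<epsilon>\<close> decreases, so the limit is a supremum.\<close>
lemma big_lower_box_dim_eq_SUP:
  "big_lower_box_dim \<pi> K q \<mu> = (SUP \<epsilon>\<in>{0<..}.
     INF E \<in> {E. E \<in> sets borel \<and> E \<subseteq> K \<and> measure \<mu> E > 1 - \<epsilon>}. lower_box_dim \<pi> K q E)"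
  unfolding big_lower_box_dim_def
  by (rule Lim_at_right_0_antimono) (auto intro!: INF_superset_mono)


text \<open>The set \<open>E m\<close> of points lying in the \<open>n\<close>-th family of balls for every \<open>n \<ge> m\<close> has measure at
  least \<open>1 - 2 * (1/2) ^ m\<close>. At the \<open>n\<close>-th scale \<open>r\<close> it is covered by at most
  \<open>r powr - (1 / real (Suc n))\<close> balls of weight at most \<open>r powr s\<close>, and the first factor
  disappears in the limit.\<close>
lemma big_lower_box_dim_le_if_concentrated:
  fixes K :: "'a::metric_space set"
  assumes "K \<in> sets borel" "\<mu> \<in> borel_probs K" "concentrated K Q \<mu>"
    and Q: "\<And>r x. 0 < r \<Longrightarrow> r < 1 \<Longrightarrow> x \<in> K \<Longrightarrow> Q r x \<Longrightarrow> measure \<pi> (ball x r) powr q \<le> r powr s"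
  shows "big_lower_box_dim \<pi> K q \<mu> \<le> ereal (- s)"
proof -
  interpret prob_space \<mu> using assms(2) by (simp add: borel_probs_def)
  note sets_\<mu> = sets_borel_probs[OF assms(2,1)] and space_\<mu> = space_borel_probs[OF assms(2)]
  obtain r F where few: "\<And>n. few_centres K Q n (r n) (F n)"
    and mass: "\<And>n. 1 - (1/2) ^ n < measure \<mu> ((\<Union>x\<in>F n. ball x (r n)) \<inter> K)"
    using assms(3) unfolding concentrated_def by metis
  define U where "U n = (\<Union>x\<in>F n. ball x (r n)) \<inter> K" for n
  define E where "E m = (\<Inter>n. U (m + n))" for m
  have U_borel: "U n \<in> sets borel" for n
    unfolding U_def by (intro sets.Int[OF borel_open assms(1)] open_UN) auto
  have E_borel: "E m \<in> sets borel" for m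
    unfolding E_def using U_borel by (intro sets.countable_INT) auto
  have E_sub: "E m \<subseteq> K" for m by (auto simp: E_def U_def)
  have U_ev: "U n \<in> events" for n using U_borel by (auto simp: sets_\<mu> U_def)
  have E_ev: "E m \<in> events" for m using E_borel E_sub by (simp add: sets_\<mu>)
  have E_mass: "1 - 2 * (1/2) ^ m \<le> measure \<mu> (E m)" for m
  proof -
    have small: "measure \<mu> (K - U (m + n)) \<le> (1/2) ^ m * (1/2) ^ n" for n
      using mass[of "m + n"] prob_compl[OF U_ev, of "m + n"] by (simp add: space_\<mu> U_def power_add)
    have geo: "(\<lambda>n. (1/2) ^ m * (1/2) ^ n :: real) sums ((1/2) ^ m * 2)"
      using geometric_sums[of "1/2 :: real"] by (intro sums_mult) simp
    have summ: "summable (\<lambda>n. measure \<mu> (K - U (m + n)))"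
      by (rule summable_comparison_test'[OF sums_summable[OF geo]]) (use small in simp)
    have "measure \<mu> (K - E m) = measure \<mu> (\<Union>n. K - U (m + n))"
      by (rule arg_cong[of _ _ "measure \<mu>"]) (auto simp: E_def)
    also have "\<dots> \<le> (\<Sum>n. measure \<mu> (K - U (m + n)))"
      using U_ev summ space_\<mu> by (intro finite_measure_subadditive_countably) auto
    also have "\<dots> \<le> (\<Sum>n. (1/2) ^ m * (1/2) ^ n)"
      by (rule suminf_le[OF small summ sums_summable[OF geo]])
    also have "\<dots> = (1/2) ^ m * 2" using geo by (simp add: sums_iff)
    finally show ?thesis using prob_compl[OF E_ev, of m] by (simp add: space_\<mu>)
  qed
  have dim: "lower_box_dim \<pi> K q (E m) \<le> ereal (- s)" for m
  proof (rule ccontr)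
    assume "\<not> ?thesis"
    then obtain t where t: "ereal (- s) < ereal t" "ereal t < lower_box_dim \<pi> K q (E m)"
      using ereal_dense2 by (metis not_le)
    have "\<forall>\<^sub>F x in at_right 0. ereal t < eln (cov_num \<pi> K q (E m) x) / ereal (- ln x)"
      using t(2) unfolding lower_box_dim_def by (rule less_LiminfD)
    then obtain b where b: "b > 0"
      "\<And>x. 0 < x \<Longrightarrow> x < b \<Longrightarrow> ereal t < eln (cov_num \<pi> K q (E m) x) / ereal (- ln x)"
      by (auto simp: eventually_at_right_field)
    obtain N where N: "1 / real (Suc N) < min b (t + s)"
      using nat_approx_posE[of "min b (t + s)"] b(1) t(1) by auto
    define n where "n = m + N"
    have n: "1 / real (Suc n) \<le> 1 / real (Suc N)" by (simp add: n_def frac_le)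
    have f: "0 < r n" "r n < 1 / real (Suc n)" "finite (F n)" "F n \<subseteq> K"
      "real (card (F n)) \<le> r n powr - (1 / real (Suc n))" "\<And>x. x \<in> F n \<Longrightarrow> Q (r n) x"
      using few[of n] by (auto simp: few_centres_def)
    have "1 / real (Suc n) \<le> 1" by simp
    then have r1: "r n < 1" using f(2) by linarith
    have "E m \<subseteq> (\<Union>x\<in>F n. ball x (r n))" by (auto simp: E_def U_def n_def)
    then have "cov_num \<pi> K q (E m) (r n) \<le> ennreal (real (card (F n)) * r n powr s)"
      using f r1 by (intro cov_num_le Q) auto
    also have "\<dots> \<le> ennreal (r n powr - (1 / real (Suc n)) * r n powr s)"
      using f(5) by (intro ennreal_leI mult_right_mono) auto
    also have "\<dots> = ennreal (r n powr (s - 1 / real (Suc n)))"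
      using f(1) by (simp add: powr_add[symmetric])
    finally have "eln (cov_num \<pi> K q (E m) (r n)) / ereal (- ln (r n)) \<le> ereal (- (s - 1 / real (Suc n)))"
      using f(1) r1 by (intro eln_quotient_le)
    moreover have "ereal t < eln (cov_num \<pi> K q (E m) (r n)) / ereal (- ln (r n))"
      using f(1,2) n N by (intro b(2)) auto
    ultimately have "ereal t < ereal (- (s - 1 / real (Suc n)))" by (rule less_le_trans[rotated])
    then show False using n N by simp
  qed
  show ?thesis
    unfolding big_lower_box_dim_eq_SUP
  proof (rule SUP_least)
    fix \<epsilon> :: real assume "\<epsilon> \<in> {0<..}"
    then obtain m where m: "(1/2) ^ m < \<epsilon> / 2"
      using real_arch_pow_inv[of "\<epsilon> / 2" "1/2"] by auto
    have "1 - \<epsilon> < measure \<mu> (E m)" using E_mass[of m] m by linarith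
    then show "(INF E \<in> {E. E \<in> sets borel \<and> E \<subseteq> K \<and> measure \<mu> E > 1 - \<epsilon>}. lower_box_dim \<pi> K q E)
        \<le> ereal (- s)"
      using E_borel E_sub dim by (intro INF_lower2[of "E m"]) auto
  qed
qed

text \<open>A set whose complement has less measure than each \<open>ball y (\<rho> / 2)\<close> meets all these balls. For
  \<open>r < \<rho> / 2\<close>, an \<open>r\<close>-ball containing a point of \<open>ball y (\<rho> / 2)\<close> has its centre in \<open>ball y \<rho>\<close>,
  where the weights are bounded below when \<open>y\<close> is chosen according to the scale.\<close>
lemma big_lower_box_dim_ge_if_full_support:
  fixes K :: "'a::metric_space set"
  assumes "K \<in> sets borel" "\<mu> \<in> borel_probs K" "full_support_on K \<mu>"
    and Y: "finite Y" "Y \<subseteq> K" "0 < \<rho>"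
    and ev: "\<forall>\<^sub>F r in at_right 0. \<exists>y\<in>Y. \<forall>x\<in>K \<inter> ball y \<rho>. r powr s \<le> measure \<pi> (ball x r) powr q"
  shows "ereal (- s) \<le> big_lower_box_dim \<pi> K q \<mu>"
proof -
  interpret prob_space \<mu> using assms(2) by (simp add: borel_probs_def)
  note sets_\<mu> = sets_borel_probs[OF assms(2,1)] and space_\<mu> = space_borel_probs[OF assms(2)]
  define m where "m y = measure \<mu> (ball y (\<rho> / 2) \<inter> K)" for y
  define \<epsilon> where "\<epsilon> = Min (insert 1 (m ` Y))"
  have m_pos: "m y > 0" if "y \<in> Y" for y
  proof -
    have "y \<in> ball y (\<rho> / 2) \<inter> K" using that Y by auto
    then show ?thesis using assms(3) unfolding m_def full_support_on_def by blast
  qed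
  then have \<epsilon>: "\<epsilon> > 0" using Y(1) by (auto simp: \<epsilon>_def)
  have \<epsilon>_le: "\<epsilon> \<le> m y" if "y \<in> Y" for y using that Y(1) by (simp add: \<epsilon>_def)
  have "ereal (- s) \<le> lower_box_dim \<pi> K q E"
    if E: "E \<in> sets borel" "E \<subseteq> K" "measure \<mu> E > 1 - \<epsilon>" for E
  proof -
    have meets: "E \<inter> ball y (\<rho> / 2) \<noteq> {}" if y: "y \<in> Y" for y
    proof
      assume "E \<inter> ball y (\<rho> / 2) = {}"
      then have "measure \<mu> (E \<union> (ball y (\<rho> / 2) \<inter> K)) = measure \<mu> E + m y"
        unfolding m_def using E(1,2) assms(1) by (intro finite_measure_Union) (auto simp: sets_\<mu>)
      then show False
        using prob_le_1[of "E \<union> (ball y (\<rho> / 2) \<inter> K)"] E(3) \<epsilon>_le[OF y] by linarith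
    qed
    have "\<forall>\<^sub>F r in at_right 0. r < min 1 (\<rho> / 2) \<and> 0 < (r::real)"
      using Y(3) unfolding eventually_at_right_field by (intro exI[of _ "min 1 (\<rho> / 2)"]) auto
    with ev have "\<forall>\<^sub>F r in at_right 0. ereal (- s) \<le> eln (cov_num \<pi> K q E r) / ereal (- ln r)"
    proof eventually_elim
      case (elim r)
      then obtain y where y: "y \<in> Y" "\<And>x. x \<in> K \<inter> ball y \<rho> \<Longrightarrow> r powr s \<le> measure \<pi> (ball x r) powr q"
        by blast
      obtain e where e: "e \<in> E" "dist y e < \<rho> / 2" using meets[OF y(1)] by auto
      have "ennreal (r powr s) \<le> cov_num \<pi> K q E r"
      proof (rule cov_num_ge[OF e(1)])
        fix x assume x: "x \<in> K" "dist x e < r"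
        have "dist y x \<le> dist y e + dist x e" by (metis dist_commute dist_triangle)
        then show "r powr s \<le> measure \<pi> (ball x r) powr q"
          using x e(2) elim by (intro y(2)) auto
      qed
      then show ?case using elim by (intro eln_quotient_ge) auto
    qed
    then show ?thesis unfolding lower_box_dim_def by (rule Liminf_bounded)
  qed
  then show ?thesis
    unfolding big_lower_box_dim_eq_SUP using \<epsilon>
    by (intro SUP_upper2[of \<epsilon>] INF_greatest) auto
qed

section \<open>The uniform dimensions of the reference measure\<close>

lemma enumerate_finite_nonempty:
  assumes "finite F" "F \<noteq> {}" "F \<subseteq> K"
  obtains y :: "nat \<Rightarrow> 'a" where "y ` {1..card F} = F" "card F \<ge> 1" "y ` {1..card F} \<subseteq> K"
proof -
  obtain y where "bij_betw y {1..card F} F" using ex_bij_betw_nat_finite_1[OF assms(1)] by auto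
  then show thesis using that[of y] assms card_gt_0_iff[of F] by (auto simp: bij_betw_def Suc_le_eq)
qed

context
  fixes \<pi> :: "'a::metric_space measure" and K :: "'a set"
  assumes finite_\<pi>: "finite_measure \<pi>"
begin

interpretation finite_measure \<pi> by (rule finite_\<pi>)

text \<open>Apply the infimum that defines the dimension to the given finite set itself: since \<open>c\<close> is below
  the upper limit of the minimum over \<open>i\<close>, at arbitrarily small scales every \<open>i\<close> satisfies
  \<open>c < log (INF \<dots>) / log r\<close>, that is, near every point there is a ball of measure less than
  \<open>r powr c\<close>.\<close>
lemma attained_nearby_light_balls:
  assumes c: "ereal c < D_unif_upper_minf \<pi> K"
  shows "attained_nearby K (\<lambda>r x. measure \<pi> (ball x r) \<le> r powr c)"
  unfolding attained_nearby_def
proof (intro allI impI, elim conjE)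
  fix F and \<rho> \<delta> :: real assume F: "finite F" "F \<subseteq> K" and \<rho>: "0 < \<rho>" and \<delta>: "0 < \<delta>"
  show "\<exists>r. 0 < r \<and> r < \<delta> \<and> (\<forall>y\<in>F. \<exists>x\<in>K. dist x y < \<rho> \<and> measure \<pi> (ball x r) \<le> r powr c)"
  proof (cases "F = {}")
    case True
    then show ?thesis using \<delta> by (intro exI[of _ "\<delta> / 2"]) auto
  next
    case False
    obtain y :: "nat \<Rightarrow> 'a" where y: "y ` {1..card F} = F" "card F \<ge> 1" "y ` {1..card F} \<subseteq> K"
      using enumerate_finite_nonempty[OF F(1) False F(2)] by metis
    let ?q = "\<lambda>r i. eln (INF x \<in> K \<inter> ball (y i) \<rho>. emeasure \<pi> (ball x r)) / ereal (ln r)"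
    have "D_unif_upper_minf \<pi> K \<le> Limsup (at_right 0) (\<lambda>r. INF i\<in>{1..card F}. ?q r i)"
      unfolding D_unif_upper_minf_def using y(2,3) \<rho>
      by (intro INF_lower2[of "card F"] INF_lower2[of "(y, \<rho>)"]) auto
    with c have lim: "ereal c < Limsup (at_right 0) (\<lambda>r. INF i\<in>{1..card F}. ?q r i)"
      by (rule less_le_trans)
    have "\<exists>r. 0 < r \<and> r < min 1 \<delta> \<and> ereal c < (INF i\<in>{1..card F}. ?q r i)"
    proof (rule ccontr)
      assume "\<not> ?thesis"
      then have "\<forall>\<^sub>F r in at_right 0. (INF i\<in>{1..card F}. ?q r i) \<le> ereal c"
        unfolding eventually_at_right_field using \<delta>
        by (intro exI[of _ "min 1 \<delta>"] conjI allI impI) (simp, meson not_less)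
      then have "Limsup (at_right 0) (\<lambda>r. INF i\<in>{1..card F}. ?q r i) \<le> ereal c"
        by (rule Limsup_bounded)
      with lim show False by (meson leD)
    qed
    then obtain r where r: "0 < r" "r < min 1 \<delta>" "ereal c < (INF i\<in>{1..card F}. ?q r i)"
      by blast
    have "\<exists>x\<in>K. dist x z < \<rho> \<and> measure \<pi> (ball x r) \<le> r powr c" if "z \<in> F" for z
    proof -
      have "z \<in> y ` {1..card F}" using that by (simp only: y(1))
      then obtain i where i: "i \<in> {1..card F}" "z = y i" by blast
      have "ereal c < ?q r i" using r(3) INF_lower[OF i(1), of "?q r"] by (rule less_le_trans)
      then have "\<not> ennreal (r powr c) \<le> (INF x \<in> K \<inter> ball (y i) \<rho>. emeasure \<pi> (ball x r))"
        using eln_ratio_le[of r c] r(1,2) by (meson min_less_iff_conj not_le)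
      then obtain x where "x \<in> K \<inter> ball (y i) \<rho>" "emeasure \<pi> (ball x r) < ennreal (r powr c)"
        by (auto simp: not_le INF_less_iff)
      then have "x \<in> K" "dist x z < \<rho>" "measure \<pi> (ball x r) \<le> r powr c"
        using i(2) by (simp_all add: emeasure_eq_measure ennreal_less_iff dist_commute)
      then show ?thesis by blast
    qed
    then show ?thesis using r(1,2) by auto
  qed
qed

text \<open>Dually, at arbitrarily small scales the maximum over \<open>i\<close> is below \<open>c\<close>, which gives heavy balls
  near every point.\<close>
lemma attained_nearby_heavy_balls:
  assumes c: "D_unif_lower_pinf \<pi> K < ereal c"
  shows "attained_nearby K (\<lambda>r x. r powr c \<le> measure \<pi> (ball x r))"
  unfolding attained_nearby_def
proof (intro allI impI, elim conjE)
  fix F and \<rho> \<delta> :: real assume F: "finite F" "F \<subseteq> K" and \<rho>: "0 < \<rho>" and \<delta>: "0 < \<delta>"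
  show "\<exists>r. 0 < r \<and> r < \<delta> \<and> (\<forall>y\<in>F. \<exists>x\<in>K. dist x y < \<rho> \<and> r powr c \<le> measure \<pi> (ball x r))"
  proof (cases "F = {}")
    case True
    then show ?thesis using \<delta> by (intro exI[of _ "\<delta> / 2"]) auto
  next
    case False
    obtain y :: "nat \<Rightarrow> 'a" where y: "y ` {1..card F} = F" "card F \<ge> 1" "y ` {1..card F} \<subseteq> K"
      using enumerate_finite_nonempty[OF F(1) False F(2)] by metis
    let ?q = "\<lambda>r i. eln (SUP x \<in> K \<inter> ball (y i) \<rho>. emeasure \<pi> (ball x r)) / ereal (ln r)"
    have "Liminf (at_right 0) (\<lambda>r. SUP i\<in>{1..card F}. ?q r i) \<le> D_unif_lower_pinf \<pi> K"
      unfolding D_unif_lower_pinf_def using y(2,3) \<rho>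
      by (intro SUP_upper2[of "card F"] SUP_upper2[of "(y, \<rho>)"]) auto
    then have lim: "Liminf (at_right 0) (\<lambda>r. SUP i\<in>{1..card F}. ?q r i) < ereal c"
      using c by (rule le_less_trans)
    have "\<exists>r. 0 < r \<and> r < min 1 \<delta> \<and> (SUP i\<in>{1..card F}. ?q r i) < ereal c"
    proof (rule ccontr)
      assume "\<not> ?thesis"
      then have "\<forall>\<^sub>F r in at_right 0. ereal c \<le> (SUP i\<in>{1..card F}. ?q r i)"
        unfolding eventually_at_right_field using \<delta>
        by (intro exI[of _ "min 1 \<delta>"] conjI allI impI) (simp, meson not_less)
      then have "ereal c \<le> Liminf (at_right 0) (\<lambda>r. SUP i\<in>{1..card F}. ?q r i)"
        by (rule Liminf_bounded)
      with lim show False by (meson leD)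
    qed
    then obtain r where r: "0 < r" "r < min 1 \<delta>" "(SUP i\<in>{1..card F}. ?q r i) < ereal c"
      by blast
    have "\<exists>x\<in>K. dist x z < \<rho> \<and> r powr c \<le> measure \<pi> (ball x r)" if "z \<in> F" for z
    proof -
      have "z \<in> y ` {1..card F}" using that by (simp only: y(1))
      then obtain i where i: "i \<in> {1..card F}" "z = y i" by blast
      have "?q r i < ereal c" using SUP_upper[OF i(1), of "?q r"] r(3) by (rule le_less_trans)
      then have "\<not> (SUP x \<in> K \<inter> ball (y i) \<rho>. emeasure \<pi> (ball x r)) \<le> ennreal (r powr c)"
        using eln_ratio_ge[of r _ c] r(1,2) by (meson min_less_iff_conj not_le)
      then obtain x where "x \<in> K \<inter> ball (y i) \<rho>" "ennreal (r powr c) < emeasure \<pi> (ball x r)"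
        by (auto simp: not_le less_SUP_iff)
      then have "x \<in> K" "dist x z < \<rho>" "r powr c \<le> measure \<pi> (ball x r)"
        using i(2) by (simp_all add: emeasure_eq_measure ennreal_less_iff dist_commute)
      then show ?thesis by blast
    qed
    then show ?thesis using r(1,2) by auto
  qed
qed

text \<open>Above the dimension only one point per scale is controlled, namely one that realises the minimum
  over \<open>i\<close>, but for it the estimate holds uniformly on a whole ball and at all small scales.\<close>
lemma D_unif_upper_minf_less:
  assumes c: "D_unif_upper_minf \<pi> K < ereal c"
  obtains Y \<rho> where "finite Y" "Y \<subseteq> K" "0 < \<rho>"
    "\<forall>\<^sub>F r in at_right 0. \<exists>y\<in>Y. \<forall>x\<in>K \<inter> ball y \<rho>. r powr c \<le> measure \<pi> (ball x r)"
proof -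
  let ?q = "\<lambda>y \<rho> r i. eln (INF x \<in> K \<inter> ball (y i) \<rho>. emeasure \<pi> (ball x r)) / ereal (ln r)"
  obtain N and y :: "nat \<Rightarrow> 'a" and \<rho> where y: "y ` {1..N} \<subseteq> K" "0 < \<rho>"
    and lim: "Limsup (at_right 0) (\<lambda>r. INF i\<in>{1..N}. ?q y \<rho> r i) < ereal c"
    using c unfolding D_unif_upper_minf_def by (auto simp: INF_less_iff)
  have "\<forall>\<^sub>F r in at_right 0. (0::real) < r \<and> r < 1"
    unfolding eventually_at_right_field by (intro exI[of _ 1]) auto
  with Limsup_lessD[OF lim]
  have "\<forall>\<^sub>F r in at_right 0. \<exists>z\<in>y ` {1..N}. \<forall>x\<in>K \<inter> ball z \<rho>. r powr c \<le> measure \<pi> (ball x r)"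
  proof eventually_elim
    case (elim r)
    then obtain i where i: "i \<in> {1..N}" "?q y \<rho> r i < ereal c" by (auto simp: INF_less_iff)
    have "\<not> (INF x \<in> K \<inter> ball (y i) \<rho>. emeasure \<pi> (ball x r)) \<le> ennreal (r powr c)"
      using eln_ratio_ge[of r _ c] elim i(2) by (meson not_le)
    then have less: "ennreal (r powr c) < (INF x \<in> K \<inter> ball (y i) \<rho>. emeasure \<pi> (ball x r))"
      by simp
    have "r powr c \<le> measure \<pi> (ball x r)" if "x \<in> K \<inter> ball (y i) \<rho>" for x
    proof -
      have "ennreal (r powr c) < emeasure \<pi> (ball x r)"
        using less INF_lower[OF that] by (rule less_le_trans)
      then show ?thesis by (simp add: emeasure_eq_measure ennreal_less_iff)
    qed
    then show ?case using i(1) by blast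
  qed
  with y show thesis by (intro that[of "y ` {1..N}" \<rho>]) auto
qed

lemma less_D_unif_lower_pinf:
  assumes c: "ereal c < D_unif_lower_pinf \<pi> K"
  obtains Y \<rho> where "finite Y" "Y \<subseteq> K" "0 < \<rho>"
    "\<forall>\<^sub>F r in at_right 0. \<exists>y\<in>Y. \<forall>x\<in>K \<inter> ball y \<rho>. measure \<pi> (ball x r) \<le> r powr c"
proof -
  let ?q = "\<lambda>y \<rho> r i. eln (SUP x \<in> K \<inter> ball (y i) \<rho>. emeasure \<pi> (ball x r)) / ereal (ln r)"
  obtain N and y :: "nat \<Rightarrow> 'a" and \<rho> where y: "y ` {1..N} \<subseteq> K" "0 < \<rho>"
    and lim: "ereal c < Liminf (at_right 0) (\<lambda>r. SUP i\<in>{1..N}. ?q y \<rho> r i)"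
    using c unfolding D_unif_lower_pinf_def by (auto simp: less_SUP_iff)
  have "\<forall>\<^sub>F r in at_right 0. (0::real) < r \<and> r < 1"
    unfolding eventually_at_right_field by (intro exI[of _ 1]) auto
  with less_LiminfD[OF lim]
  have "\<forall>\<^sub>F r in at_right 0. \<exists>z\<in>y ` {1..N}. \<forall>x\<in>K \<inter> ball z \<rho>. measure \<pi> (ball x r) \<le> r powr c"
  proof eventually_elim
    case (elim r)
    then obtain i where i: "i \<in> {1..N}" "ereal c < ?q y \<rho> r i" by (auto simp: less_SUP_iff)
    have "\<not> ennreal (r powr c) \<le> (SUP x \<in> K \<inter> ball (y i) \<rho>. emeasure \<pi> (ball x r))"
      using eln_ratio_le[of r c] elim i(2) by (meson not_le)
    then have less: "(SUP x \<in> K \<inter> ball (y i) \<rho>. emeasure \<pi> (ball x r)) < ennreal (r powr c)"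
      by simp
    have "measure \<pi> (ball x r) \<le> r powr c" if "x \<in> K \<inter> ball (y i) \<rho>" for x
    proof -
      have "emeasure \<pi> (ball x r) < ennreal (r powr c)"
        using SUP_upper[OF that] less by (rule le_less_trans)
      then show ?thesis by (simp add: emeasure_eq_measure ennreal_less_iff)
    qed
    then show ?case using i(1) by blast
  qed
  with y show thesis by (intro that[of "y ` {1..N}" \<rho>]) auto
qed

end

text \<open>Asking for the upper bound only at rational thresholds keeps the family of conditions imposed
  on a typical measure countable.\<close>
lemma ereal_eq_mult_if_rational_bounds:
  fixes q :: real and D X :: ereal
  assumes "0 < q"
    and upper: "\<And>c. c \<in> \<rat> \<Longrightarrow> ereal c < D \<Longrightarrow> X \<le> ereal (- (q * c))"
    and lower: "\<And>c. D < ereal c \<Longrightarrow> ereal (- (q * c)) \<le> X"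
  shows "X = ereal (- q) * D"
proof (rule antisym)
  show "X \<le> ereal (- q) * D"
  proof (rule ccontr)
    assume "\<not> ?thesis"
    then obtain t where t: "ereal (- q) * D < ereal t" "ereal t < X" by (metis ereal_dense2 not_le)
    have "ereal (- t / q) < D" using t(1) assms(1) by (cases D) (auto simp: field_simps)
    then obtain u where u: "ereal (- t / q) < ereal u" "ereal u < D" by (metis ereal_dense2)
    then obtain c where c: "c \<in> \<rat>" "- t / q < c" "c < u"
      using Rats_dense_in_real by (metis ereal_less_ereal_Ex less_ereal.simps(1))
    then have "X \<le> ereal (- (q * c))" using u(2) by (intro upper) (auto intro: less_trans[of _ "ereal u"])
    moreover have "- (q * c) < t" using c(2) assms(1) by (simp add: field_simps)
    ultimately show False using t(2) by (metis ereal_less_eq(3) le_less_trans less_ereal.simps(1) less_imp_not_less not_le)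
  qed
  show "ereal (- q) * D \<le> X"
  proof (rule ccontr)
    assume "\<not> ?thesis"
    then obtain t where t: "X < ereal t" "ereal t < ereal (- q) * D" by (metis ereal_dense2 not_le)
    have "D < ereal (- t / q)" using t(2) assms(1) by (cases D) (auto simp: field_simps)
    then have "ereal (- (q * (- t / q))) \<le> X" by (rule lower)
    then show False using t(1) assms(1) by simp
  qed
qed

theorem theorem1p3:
  fixes \<pi> :: "'a::euclidean_space measure" and K :: "'a set"
  assumes "prob_space \<pi>" and "sets \<pi> = sets borel"
    and "K = msupport \<pi>" and "compact K"
  shows "typical K (\<lambda>\<mu>. \<forall>q::real.
           (q \<ge> 0 \<longrightarrow> big_lower_box_dim \<pi> K q \<mu> = ereal (- q) * D_unif_upper_minf \<pi> K) \<and>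
           (q \<le> 0 \<longrightarrow> big_lower_box_dim \<pi> K q \<mu> = ereal (- q) * D_unif_lower_pinf \<pi> K))"
proof -
  interpret prob_space \<pi> by (rule assms(1))
  have fin: "finite_measure \<pi>" by (rule finite_measure_axioms)
  have K: "K \<in> sets borel" using assms(4) by (simp add: compact_imp_closed)
  have pos: "0 < measure \<pi> (ball x r)" if "x \<in> K" "0 < r" for x r
  proof -
    have "0 < emeasure \<pi> (ball x r)" using that assms(3) by (auto simp: msupport_def)
    then show ?thesis by (simp add: emeasure_eq_measure)
  qed
  let ?D = "D_unif_upper_minf \<pi> K" and ?D' = "D_unif_lower_pinf \<pi> K"
  define light where "light c = (\<lambda>r x. measure \<pi> (ball x r) \<le> r powr c)" for c
  define heavy where "heavy c = (\<lambda>r x. r powr c \<le> measure \<pi> (ball x r))" for c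
  \<comment> \<open>This type yields the upper bound at \<open>q = 0\<close>, where every ball has weight 1.\<close>
  define anything where "anything = (\<lambda>(r::real) (x::'a). True)"
  define \<Q> where "\<Q> = insert anything
    (light ` {c \<in> \<rat>. ereal c < ?D} \<union> heavy ` {c \<in> \<rat>. ?D' < ereal c})"
  have "countable {c \<in> \<rat>. P c}" for P :: "real \<Rightarrow> bool"
    by (rule countable_subset[OF _ countable_rat]) auto
  then have "countable \<Q>" unfolding \<Q>_def by auto
  moreover have "attained_nearby K Q" if "Q \<in> \<Q>" for Q
  proof -
    have "attained_nearby K anything"
      unfolding attained_nearby_def anything_def
    proof (intro allI impI)
      fix F and \<rho> \<delta> :: real assume "finite F \<and> F \<subseteq> K \<and> 0 < \<rho> \<and> 0 < \<delta>"
      then show "\<exists>r. 0 < r \<and> r < \<delta> \<and> (\<forall>y\<in>F. \<exists>x\<in>K. dist x y < \<rho> \<and> True)"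
        by (intro exI[of _ "\<delta> / 2"]) force
    qed
    then show ?thesis
      using that attained_nearby_light_balls[OF fin] attained_nearby_heavy_balls[OF fin]
      by (auto simp: \<Q>_def light_def heavy_def)
  qed
  ultimately have generic: "typical K (\<lambda>\<mu>. \<mu> \<in> borel_probs K \<and> full_support_on K \<mu> \<and>
      (\<forall>Q\<in>\<Q>. concentrated K Q \<mu>))"
    by (rule typical_full_support_concentrated[OF assms(4)])
  have dims: "(q \<ge> 0 \<longrightarrow> big_lower_box_dim \<pi> K q \<mu> = ereal (- q) * ?D) \<and>
     (q \<le> 0 \<longrightarrow> big_lower_box_dim \<pi> K q \<mu> = ereal (- q) * ?D')"
    if bp: "\<mu> \<in> borel_probs K" and full: "full_support_on K \<mu>"
      and conc: "\<And>Q. Q \<in> \<Q> \<Longrightarrow> concentrated K Q \<mu>" for \<mu> q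
  proof -
    let ?X = "big_lower_box_dim \<pi> K q \<mu>"
    note upper = big_lower_box_dim_le_if_concentrated[OF K bp conc]
    note lower = big_lower_box_dim_ge_if_full_support[OF K bp full]
    consider "q = 0" | "q > 0" | "q < 0" by linarith
    then show ?thesis
    proof cases
      case 1
      have "?X \<le> ereal (- 0)"
        by (rule upper[of anything]) (use 1 pos in \<open>auto simp: \<Q>_def\<close>)
      moreover have "ereal (- 0) \<le> ?X"
      proof -
        have "prob_space \<mu>" using bp by (simp add: borel_probs_def)
        then have "K \<noteq> {}" using prob_space.not_empty space_borel_probs[OF bp] by blast
        then obtain y where y: "y \<in> K" by auto
        have "\<forall>\<^sub>F r in at_right 0. (0::real) < r"
          by (simp add: eventually_at_right_less)
        then have "\<forall>\<^sub>F r in at_right 0. \<exists>z\<in>{y}. \<forall>x\<in>K \<inter> ball z 1. r powr 0 \<le> measure \<pi> (ball x r) powr q"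
        proof eventually_elim
          case (elim r)
          have "r powr 0 \<le> measure \<pi> (ball x r) powr q" if "x \<in> K" for x
            using pos[OF that elim] 1 elim by simp
          then show ?case by blast
        qed
        with y show ?thesis by (intro lower[of "{y}" 1]) auto
      qed
      ultimately have "?X = 0" by (simp add: zero_ereal_def[symmetric])
      then show ?thesis using 1 by (simp add: zero_ereal_def[symmetric])
    next
      case 2
      have "?X = ereal (- q) * ?D"
      proof (rule ereal_eq_mult_if_rational_bounds[OF 2])
        fix c assume c: "c \<in> \<rat>" "ereal c < ?D"
        show "?X \<le> ereal (- (q * c))"
        proof (rule upper[of "light c"])
          fix r x assume "0 < r" "x \<in> K" "light c r x"
          then have "measure \<pi> (ball x r) powr q \<le> (r powr c) powr q"
            using 2 by (intro powr_mono2) (auto simp: light_def)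
          then show "measure \<pi> (ball x r) powr q \<le> r powr (q * c)"
            by (simp add: powr_powr mult.commute)
        qed (use c in \<open>auto simp: \<Q>_def\<close>)
      next
        fix c assume "?D < ereal c"
        from D_unif_upper_minf_less[OF fin this] obtain Y \<rho> where Y: "finite Y" "Y \<subseteq> K" "0 < \<rho>"
          and ev: "\<forall>\<^sub>F r in at_right 0. \<exists>y\<in>Y. \<forall>x\<in>K \<inter> ball y \<rho>. r powr c \<le> measure \<pi> (ball x r)"
          by blast
        from ev have "\<forall>\<^sub>F r in at_right 0. \<exists>y\<in>Y. \<forall>x\<in>K \<inter> ball y \<rho>. r powr (q * c) \<le> measure \<pi> (ball x r) powr q"
        proof eventually_elim
          case (elim r)
          have "r powr (q * c) \<le> measure \<pi> (ball x r) powr q"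
            if "r powr c \<le> measure \<pi> (ball x r)" for x
            using powr_mono2[of q, OF _ _ that] 2 by (simp add: powr_powr mult.commute)
          then show ?case using elim by blast
        qed
        then show "ereal (- (q * c)) \<le> ?X" by (rule lower[OF Y])
      qed
      then show ?thesis using 2 by simp
    next
      case 3
      \<comment> \<open>The case of a positive exponent, read for \<open>- q\<close> and \<open>- ?D'\<close>.\<close>
      have "?X = ereal (- (- q)) * (- ?D')"
      proof (rule ereal_eq_mult_if_rational_bounds)
        fix c assume c: "c \<in> \<rat>" "ereal c < - ?D'"
        have c': "?D' < ereal (- c)" using c(2) by (cases ?D') auto
        show "?X \<le> ereal (- (- q * c))"
        proof (rule upper[of "heavy (- c)"])
          fix r x assume "0 < r" "x \<in> K" "heavy (- c) r x"
          then have "measure \<pi> (ball x r) powr q \<le> (r powr (- c)) powr q"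
            using 3 by (intro powr_mono2') (auto simp: heavy_def)
          then show "measure \<pi> (ball x r) powr q \<le> r powr (- q * c)"
            by (simp add: powr_powr mult.commute)
        qed (use c c' in \<open>auto simp: \<Q>_def\<close>)
      next
        fix c assume "- ?D' < ereal c"
        then have "ereal (- c) < ?D'" by (cases ?D') auto
        from less_D_unif_lower_pinf[OF fin this] obtain Y \<rho> where Y: "finite Y" "Y \<subseteq> K" "0 < \<rho>"
          and ev: "\<forall>\<^sub>F r in at_right 0. \<exists>y\<in>Y. \<forall>x\<in>K \<inter> ball y \<rho>. measure \<pi> (ball x r) \<le> r powr (- c)"
          by blast
        have "\<forall>\<^sub>F r in at_right 0. (0::real) < r"
          by (simp add: eventually_at_right_less)
        with ev have "\<forall>\<^sub>F r in at_right 0. \<exists>y\<in>Y. \<forall>x\<in>K \<inter> ball y \<rho>. r powr (- q * c) \<le> measure \<pi> (ball x r) powr q"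
        proof eventually_elim
          case (elim r)
          have "r powr (- q * c) \<le> measure \<pi> (ball x r) powr q"
            if "measure \<pi> (ball x r) \<le> r powr (- c)" "x \<in> K" for x
            using powr_mono2'[of q, OF _ pos[OF that(2) elim(2)] that(1)] 3
            by (simp add: powr_powr mult.commute)
          then show ?case using elim(1) by blast
        qed
        then show "ereal (- (- q * c)) \<le> ?X" by (rule lower[OF Y])
      qed (use 3 in simp)
      also have "\<dots> = ereal (- q) * ?D'" using 3 by (cases ?D') auto
      finally show ?thesis using 3 by simp
    qed
  qed
  show ?thesis
    using generic dims unfolding typical_def by blast
qed

end
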